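(* Let $\mathcal{P}$, $\mathcal{Q}$ be properties of (possibly infinitely generated) modules over local rings and let $\leq$ be a relation of modules over local rings. Assume that $\mathcal{P}$, $\mathcal{Q}$ and $\leq$ satisfy the following conditions for all local rings $(R,\mathfrak{m},k)$ and all $R$-modules $X$, $Y$: (1) If $\operatorname{depth} R>0$ and $X$ satisfies $\mathcal{P}$ as an $R$-module, then there exist finitely many non-maximal prime ideals $\mathfrak{p}_1,\dots,\mathfrak{p}_n$ of $R$ such that $X/xX$ satisfies $\mathcal{P}$ as an $R/xR$-module for every $R$-regular element $x\in\mathfrak{m}\setminus(\mathfrak{m}^2\cup(\bigcup_{i=1}^n\mathfrak{p}_i))$; and the same condition holds with $\mathcal{P}$ replaced throughout by $\mathcal{Q}$. (2) If $\operatorname{depth} R=0$ and $X$ satisfies $\mathcal{P}$ as an $R$-module, then $\operatorname{Soc} R\not\subset\operatorname{Ann}_R X$. (3) If $\operatorname{depth} R=0$, $X$ satisfies $\mathcal{Q}$ as an $R$-module, and $R\neq k$, then $\operatorname{Soc} R\subset\operatorname{Ann}_R X$. (4) If $\operatorname{depth} R>0$ and $X\leq_R Y$, then there exist finitely many non-maximal prime ideals $\mathfrak{p}_1,\dots,\mathfrak{p}_n$ of $R$ such that $X/xX\leq_{R/xR}Y/xY$ for every $R$-regular element $x\in\mathfrak{m}\setminus(\mathfrak{m}^2\cup(\bigcup_{i=1}^n\mathfrak{p}_i))$. (5) If $\operatorname{depth} R=0$ and $X\leq_R Y$, then $\operatorname{Ann}_R X\subset\operatorname{Ann}_R Y$.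 Then a local ring $R$ is regular if there exist $R$-modules $M,N$ such that $M$ satisfies $\mathcal{Q}$, $N$ satisfies $\mathcal{P}$, and $M\leq_R N$.
   Context: All rings are commutative and noetherian. $(R,\mathfrak{m},k)$ denotes a local ring with maximal ideal $\mathfrak{m}$ and residue field $k$; "$R\neq k$" means that $R$ is not a field. Modules are not assumed to be finitely generated. An element $x\in R$ is $R$-regular if it is a non-zerodivisor on $R$. $\operatorname{Soc} R=(0:_R\mathfrak{m})$ is the socle of $R$. A property $\mathcal{P}$ of modules over local rings specifies, for each local ring $R$, which $R$-modules satisfy $\mathcal{P}$. A relation $\leq$ of modules over local rings specifies, for each local ring $R$, a binary relation $\leq_R$ on $R$-modules. *)

theory Defs
  imports "HOL-Algebra.Module" "HOL-Algebra.QuotRing" "HOL-Algebra.Ideal_Product"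
    "HOL-Algebra.Ring_Divisibility" "HOL-Library.Extended_Nat"
begin

section \<open>Local rings\<close>

locale noeth_local_ring = cring R + noetherian_ring R for R (structure) +
  assumes unique_maximal: "\<exists>!\<mm>. maximalideal \<mm> R"

definition max_ideal :: "('a, 'b) ring_scheme \<Rightarrow> 'a set" where
  "max_ideal R = (THE \<mm>. maximalideal \<mm> R)"

definition socle :: "('a, 'b) ring_scheme \<Rightarrow> 'a set" where
  "socle R = {a \<in> carrier R. \<forall>b \<in> max_ideal R. b \<otimes>\<^bsub>R\<^esub> a = \<zero>\<^bsub>R\<^esub>}"

definition annihilator :: "('a, 'b) ring_scheme \<Rightarrow> ('a, 'm, 'c) module_scheme \<Rightarrow> 'a set" where
  "annihilator R V = {a \<in> carrier R. \<forall>v \<in> carrier V. a \<odot>\<^bsub>V\<^esub> v = \<zero>\<^bsub>V\<^esub>}"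

definition regular_element :: "('a, 'b) ring_scheme \<Rightarrow> 'a \<Rightarrow> bool" where
  "regular_element R x \<longleftrightarrow>
     x \<in> carrier R \<and> (\<forall>a \<in> carrier R. x \<otimes>\<^bsub>R\<^esub> a = \<zero>\<^bsub>R\<^esub> \<longrightarrow> a = \<zero>\<^bsub>R\<^esub>)"

text \<open>
  The usual extra requirement that the quotient of \<open>R\<close> by the whole sequence is nonzero holds
  automatically, because \<open>depth\<close> only uses sequences in the maximal ideal.
\<close>

definition regular_seq :: "('a, 'b) ring_scheme \<Rightarrow> 'a list \<Rightarrow> bool" where
  "regular_seq R xs \<longleftrightarrow> (\<forall>i < length xs.
     let I = Idl\<^bsub>R\<^esub> (set (take i xs)) in regular_element (R Quot I) (I +>\<^bsub>R\<^esub> (xs ! i)))"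

definition depth :: "('a, 'b) ring_scheme \<Rightarrow> enat" where
  "depth R = Sup {enat (length xs) | xs. set xs \<subseteq> max_ideal R \<and> regular_seq R xs}"

definition krull_dim :: "('a, 'b) ring_scheme \<Rightarrow> enat" where
  "krull_dim R = Sup {enat n | n.
     \<exists>p :: nat \<Rightarrow> 'a set. (\<forall>i \<le> n. primeideal (p i) R) \<and> (\<forall>i < n. p i \<subset> p (Suc i))}"

definition regular_local_ring :: "('a, 'b) ring_scheme \<Rightarrow> bool" where
  "regular_local_ring R \<longleftrightarrow> noeth_local_ring R \<and>
     (\<exists>A \<subseteq> carrier R. finite A \<and> enat (card A) = krull_dim R \<and> Idl\<^bsub>R\<^esub> A = max_ideal R)"


section \<open>Quotients inside a fixed type\<close>

text \<open>
  The elements of \<^term>\<open>R Quot I\<close> are cosets, so it has type \<^typ>\<open>'a set ring\<close> when \<open>R\<close> has type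
  \<^typ>\<open>'a ring\<close>.  A predicate on modules over local rings has to be applicable both to \<open>R\<close>
  and to its quotients, so quotients are realised here on a chosen system of coset
  representatives, which keeps the element type.  The lemmas below show that this is the usual
  quotient up to isomorphism.
\<close>

definition coset_rep :: "('a, 'b) ring_scheme \<Rightarrow> 'a set \<Rightarrow> 'a \<Rightarrow> 'a" where
  "coset_rep G H a = (SOME b. b \<in> H +>\<^bsub>G\<^esub> a)"

definition quot_ring :: "('a, 'b) ring_scheme \<Rightarrow> 'a set \<Rightarrow> 'a ring" where
  "quot_ring R I =
     \<lparr>carrier = coset_rep R I ` carrier R,
      monoid.mult = (\<lambda>a b. coset_rep R I (a \<otimes>\<^bsub>R\<^esub> b)),
      one = coset_rep R I \<one>\<^bsub>R\<^esub>,
      zero = coset_rep R I \<zero>\<^bsub>R\<^esub>,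
      add = (\<lambda>a b. coset_rep R I (a \<oplus>\<^bsub>R\<^esub> b))\<rparr>"

text \<open>
  The fields \<open>mult\<close> and \<open>one\<close> of a module record have no meaning for modules.
\<close>

definition quot_module :: "('a, 'm, 'c) module_scheme \<Rightarrow> 'm set \<Rightarrow> ('a, 'm) module" where
  "quot_module V N =
     \<lparr>carrier = coset_rep V N ` carrier V,
      monoid.mult = undefined,
      one = undefined,
      zero = coset_rep V N \<zero>\<^bsub>V\<^esub>,
      add = (\<lambda>v w. coset_rep V N (v \<oplus>\<^bsub>V\<^esub> w)),
      smult = (\<lambda>a v. coset_rep V N (a \<odot>\<^bsub>V\<^esub> v))\<rparr>"

definition ring_mod_elem :: "('a, 'b) ring_scheme \<Rightarrow> 'a \<Rightarrow> 'a ring" where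
  "ring_mod_elem R x = quot_ring R (PIdl\<^bsub>R\<^esub> x)"

definition module_mod_elem :: "('a, 'm, 'c) module_scheme \<Rightarrow> 'a \<Rightarrow> ('a, 'm) module" where
  "module_mod_elem V x = quot_module V ((\<lambda>v. x \<odot>\<^bsub>V\<^esub> v) ` carrier V)"

lemma coset_rep_in:
  assumes "abelian_subgroup H G" "a \<in> carrier G"
  shows "coset_rep G H a \<in> H +>\<^bsub>G\<^esub> a"
proof -
  interpret abelian_subgroup H G by fact
  show ?thesis
    unfolding coset_rep_def by (rule someI[of _ a]) (rule a_rcos_self[OF assms(2)])
qed

lemma coset_rep_closed:
  assumes "abelian_subgroup H G" "a \<in> carrier G"
  shows "coset_rep G H a \<in> carrier G"
proof -
  interpret abelian_subgroup H G by fact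
  show ?thesis
    using coset_rep_in[OF assms] a_r_coset_subset_G[OF a_subset assms(2)] by blast
qed

lemma coset_coset_rep:
  assumes "abelian_subgroup H G" "a \<in> carrier G"
  shows "H +>\<^bsub>G\<^esub> coset_rep G H a = H +>\<^bsub>G\<^esub> a"
proof -
  interpret abelian_subgroup H G by fact
  show ?thesis
    using a_repr_independence'[OF coset_rep_in[OF assms] assms(2)] by simp
qed

lemma coset_rep_eq_iff_coset:
  assumes "abelian_subgroup H G" "a \<in> carrier G" "b \<in> carrier G"
  shows "coset_rep G H a = coset_rep G H b \<longleftrightarrow> H +>\<^bsub>G\<^esub> a = H +>\<^bsub>G\<^esub> b"
  using coset_coset_rep[OF assms(1,2)] coset_coset_rep[OF assms(1,3)]
  by (metis coset_rep_def)

lemma coset_rep_eq_iff: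
  assumes "abelian_subgroup H G" "a \<in> carrier G" "b \<in> carrier G"
  shows "coset_rep G H a = coset_rep G H b \<longleftrightarrow> a \<ominus>\<^bsub>G\<^esub> b \<in> H"
proof -
  interpret abelian_subgroup H G by fact
  have "H +>\<^bsub>G\<^esub> a = H +>\<^bsub>G\<^esub> b \<longleftrightarrow> a \<in> H +>\<^bsub>G\<^esub> b"
    using a_rcos_self[OF assms(2)] a_repr_independence'[OF _ assms(3)] by metis
  also have "\<dots> \<longleftrightarrow> a \<ominus>\<^bsub>G\<^esub> b \<in> H"
    using a_rcos_module[OF assms(3,2)] by (simp add: a_minus_def)
  finally show ?thesis
    unfolding coset_rep_eq_iff_coset[OF assms] .
qed

lemma coset_rep_add:
  assumes "abelian_subgroup H G" "a \<in> carrier G" "b \<in> carrier G"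
  shows "coset_rep G H (coset_rep G H a \<oplus>\<^bsub>G\<^esub> coset_rep G H b) = coset_rep G H (a \<oplus>\<^bsub>G\<^esub> b)"
proof -
  interpret abelian_subgroup H G by fact
  show ?thesis
    using assms coset_rep_eq_iff_coset[OF assms(1), of "coset_rep G H a \<oplus>\<^bsub>G\<^esub> coset_rep G H b" "a \<oplus>\<^bsub>G\<^esub> b"]
    by (metis coset_coset_rep coset_rep_closed add.m_closed a_rcos_sum)
qed

lemma coset_rep_mult:
  assumes "ideal I R" "a \<in> carrier R" "b \<in> carrier R"
  shows "coset_rep R I (coset_rep R I a \<otimes>\<^bsub>R\<^esub> coset_rep R I b) = coset_rep R I (a \<otimes>\<^bsub>R\<^esub> b)"
proof -
  interpret ideal I R by fact
  have as: "abelian_subgroup I R" by unfold_locales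
  show ?thesis
    using assms coset_rep_eq_iff_coset[OF as, of "coset_rep R I a \<otimes>\<^bsub>R\<^esub> coset_rep R I b" "a \<otimes>\<^bsub>R\<^esub> b"]
    by (metis coset_coset_rep[OF as] coset_rep_closed[OF as] m_closed rcoset_mult_add)
qed

theorem quot_ring_iso:
  fixes R (structure)
  assumes "ideal I R"
  shows "(\<lambda>C. SOME b. b \<in> C) \<in> ring_iso (R Quot I) (quot_ring R I)"
proof -
  interpret ideal I R by fact
  let ?h = "\<lambda>C. SOME b. b \<in> C"
  let ?r = "coset_rep R I"
  have as: "abelian_subgroup I R" by unfold_locales
  have h: "?h (I +> a) = ?r a" for a by (simp add: coset_rep_def)
  have car: "carrier (R Quot I) = (\<lambda>a. I +> a) ` carrier R"
    by (auto simp: FactRing_def A_RCOSETS_def RCOSETS_def a_r_coset_def)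
  note mult = coset_rep_mult[OF assms] and add = coset_rep_add[OF as]
  have inj: "inj_on ?h (carrier (R Quot I))"
    by (auto simp: inj_on_def car h coset_rep_eq_iff_coset[OF as])
  have hom: "?h \<in> ring_hom (R Quot I) (quot_ring R I)"
  proof (rule ring_hom_memI)
    fix C assume "C \<in> carrier (R Quot I)"
    then show "?h C \<in> carrier (quot_ring R I)" by (auto simp: car h quot_ring_def)
  next
    fix C D assume "C \<in> carrier (R Quot I)" "D \<in> carrier (R Quot I)"
    then obtain a b where ab: "a \<in> carrier R" "b \<in> carrier R" "C = I +> a" "D = I +> b"
      by (auto simp: car)
    show "?h (C \<otimes>\<^bsub>R Quot I\<^esub> D) = ?h C \<otimes>\<^bsub>quot_ring R I\<^esub> ?h D"
      using ab mult by (simp add: FactRing_def quot_ring_def rcoset_mult_add h)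
    show "?h (C \<oplus>\<^bsub>R Quot I\<^esub> D) = ?h C \<oplus>\<^bsub>quot_ring R I\<^esub> ?h D"
      using ab add by (simp add: FactRing_def quot_ring_def a_rcos_sum h)
  qed (simp add: FactRing_def quot_ring_def h)
  have "?h ` carrier (R Quot I) = carrier (quot_ring R I)"
    by (simp add: car image_image h quot_ring_def)
  with inj hom show ?thesis by (simp add: ring_iso_def bij_betw_def)
qed

theorem quot_ring_cring:
  fixes R (structure)
  assumes "cring R" "ideal I R"
  shows "cring (quot_ring R I)"
proof -
  interpret ideal I R by fact
  interpret Q: cring "R Quot I" by (rule quotient_is_cring[OF assms(1)])
  have "I +> \<zero> = I"
    by (rule a_coset_join2[OF zero_closed a_subgroup additive_subgroup.zero_closed[OF additive_subgroup_axioms]])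
  then have some: "(SOME b. b \<in> I) = coset_rep R I \<zero>"
    by (simp add: coset_rep_def)
  show ?thesis
    using some Q.ring_iso_imp_img_cring[OF quot_ring_iso[OF assms(2)]]
    by (simp add: FactRing_def quot_ring_def)
qed

theorem quot_module_module:
  fixes R (structure)
  assumes "module R V" "ideal I R" "submodule N R V"
    and IN: "\<And>a v. a \<in> I \<Longrightarrow> v \<in> carrier V \<Longrightarrow> a \<odot>\<^bsub>V\<^esub> v \<in> N"
  shows "module (quot_ring R I) (quot_module V N)"
proof -
  interpret V: module R V by fact
  interpret I: ideal I R by fact
  interpret N: submodule N R V by fact
  have asI: "abelian_subgroup I R" by unfold_locales
  have asN: "abelian_subgroup N V"
    by (intro abelian_subgroupI3 additive_subgroup.intro N.subgroup_axioms V.abelian_group_axioms)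
  interpret N: abelian_subgroup N V by (rule asN)
  let ?r = "coset_rep R I" and ?s = "coset_rep V N"
  note rcl = coset_rep_closed[OF asI] and scl = coset_rep_closed[OF asN]
  note add = coset_rep_add[OF asN]
  have idem: "?s (?s v) = ?s v" if "v \<in> carrier V" for v
    using that by (metis coset_coset_rep[OF asN] coset_rep_eq_iff_coset[OF asN] scl)
  have add1: "?s (?s v \<oplus>\<^bsub>V\<^esub> w) = ?s (v \<oplus>\<^bsub>V\<^esub> w)" and add2: "?s (v \<oplus>\<^bsub>V\<^esub> ?s w) = ?s (v \<oplus>\<^bsub>V\<^esub> w)"
    if "v \<in> carrier V" "w \<in> carrier V" for v w
    using that by (metis add idem scl)+
  have smult: "?s (?r a \<odot>\<^bsub>V\<^esub> ?s v) = ?s (a \<odot>\<^bsub>V\<^esub> v)"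
    if a: "a \<in> carrier R" and v: "v \<in> carrier V" for a v
  proof -
    have "?r a \<ominus> a \<in> I"
      using coset_rep_eq_iff[OF asI rcl[OF a] a] coset_coset_rep[OF asI a]
        coset_rep_eq_iff_coset[OF asI rcl[OF a] a] by simp
    then obtain i where i: "i \<in> I" "?r a = i \<oplus> a"
      using coset_rep_in[OF asI a] by (auto simp: a_r_coset_def r_coset_def)
    obtain n where n: "n \<in> N" "?s v = n \<oplus>\<^bsub>V\<^esub> v"
      using coset_rep_in[OF asN v] by (auto simp: a_r_coset_def r_coset_def)
    have ic: "i \<in> carrier R" using i(1) by (rule I.a_Hcarr)
    have nc: "n \<in> carrier V" using n(1) by (rule N.a_Hcarr)
    have "?r a \<odot>\<^bsub>V\<^esub> ?s v = (i \<odot>\<^bsub>V\<^esub> ?s v \<oplus>\<^bsub>V\<^esub> a \<odot>\<^bsub>V\<^esub> n) \<oplus>\<^bsub>V\<^esub> a \<odot>\<^bsub>V\<^esub> v"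
      using ic a v nc scl[OF v] i(2) n(2)
      by (simp add: V.smult_l_distr V.smult_r_distr V.a_ac)
    moreover have "i \<odot>\<^bsub>V\<^esub> ?s v \<oplus>\<^bsub>V\<^esub> a \<odot>\<^bsub>V\<^esub> n \<in> N"
      using IN[OF i(1) scl[OF v]] N.smult_closed[OF a n(1)] by (rule N.a_closed)
    ultimately have "?r a \<odot>\<^bsub>V\<^esub> ?s v \<in> N +>\<^bsub>V\<^esub> (a \<odot>\<^bsub>V\<^esub> v)"
      by (auto simp: a_r_coset_def r_coset_def)
    then have "N +>\<^bsub>V\<^esub> (?r a \<odot>\<^bsub>V\<^esub> ?s v) = N +>\<^bsub>V\<^esub> (a \<odot>\<^bsub>V\<^esub> v)"
      using N.a_repr_independence' a v by auto
    then show ?thesis by (simp add: coset_rep_def)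
  qed
  have idr: "?r (?r a) = ?r a" if "a \<in> carrier R" for a
    using that by (metis coset_coset_rep[OF asI] coset_rep_eq_iff_coset[OF asI] rcl)
  have smult1: "?s (?r a \<odot>\<^bsub>V\<^esub> v) = ?s (a \<odot>\<^bsub>V\<^esub> v)" and smult2: "?s (a \<odot>\<^bsub>V\<^esub> ?s v) = ?s (a \<odot>\<^bsub>V\<^esub> v)"
    if "a \<in> carrier R" "v \<in> carrier V" for a v
    using that by (metis smult idem idr rcl scl)+
  have smult3: "?s (a \<odot>\<^bsub>V\<^esub> (?r b \<odot>\<^bsub>V\<^esub> v)) = ?s (a \<odot>\<^bsub>V\<^esub> (b \<odot>\<^bsub>V\<^esub> v))"
    if "a \<in> carrier R" "b \<in> carrier R" "v \<in> carrier V" for a b v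
    using that by (metis smult1 smult2 rcl V.smult_closed)
  note simps = quot_ring_def quot_module_def coset_rep_mult[OF assms(2)] coset_rep_add[OF asI] add add1 add2 smult smult1 smult2 smult3 idem idr rcl scl
  have ag: "abelian_group (quot_module V N)"
  proof (rule abelian_groupI)
    fix v assume "v \<in> carrier (quot_module V N)"
    then obtain v' where v': "v' \<in> carrier V" "v = ?s v'" by (auto simp: simps)
    then show "\<exists>y \<in> carrier (quot_module V N). y \<oplus>\<^bsub>quot_module V N\<^esub> v = \<zero>\<^bsub>quot_module V N\<^esub>"
      by (intro bexI[of _ "?s (\<ominus>\<^bsub>V\<^esub> v')"]) (auto simp: simps V.l_neg)
  next
    fix v w assume "v \<in> carrier (quot_module V N)" "w \<in> carrier (quot_module V N)"
    then obtain v' w' where "v' \<in> carrier V" "v = ?s v'" "w' \<in> carrier V" "w = ?s w'"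
      by (auto simp: simps)
    then show "v \<oplus>\<^bsub>quot_module V N\<^esub> w = w \<oplus>\<^bsub>quot_module V N\<^esub> v"
      by (simp add: simps V.a_comm[of v' w'])
  qed (auto simp: simps V.a_assoc)
  show ?thesis
    by (rule moduleI[OF quot_ring_cring[OF V.R.is_cring assms(2)] ag])
      (auto simp: simps V.smult_l_distr[symmetric] V.smult_r_distr[symmetric] V.smult_assoc1)
qed

corollary module_mod_elem_module:
  fixes R (structure)
  assumes "module R V" "x \<in> carrier R"
  shows "module (ring_mod_elem R x) (module_mod_elem V x)"
proof -
  interpret module R V by fact
  let ?N = "(\<lambda>v. x \<odot>\<^bsub>V\<^esub> v) ` carrier V"
  have comm: "a \<odot>\<^bsub>V\<^esub> (x \<odot>\<^bsub>V\<^esub> v) = x \<odot>\<^bsub>V\<^esub> (a \<odot>\<^bsub>V\<^esub> v)" if "a \<in> carrier R" "v \<in> carrier V" for a v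
    using that assms(2) by (metis R.m_comm smult_assoc1)
  have sub: "submodule ?N R V"
  proof (rule submoduleI)
    show "\<zero>\<^bsub>V\<^esub> \<in> ?N" using assms(2) by (intro image_eqI[of _ _ "\<zero>\<^bsub>V\<^esub>"]) simp_all
    show "\<ominus>\<^bsub>V\<^esub> a \<in> ?N" if "a \<in> ?N" for a
      using that assms(2) by (auto simp: smult_r_minus[symmetric])
    show "a \<oplus>\<^bsub>V\<^esub> b \<in> ?N" if "a \<in> ?N" "b \<in> ?N" for a b
      using that assms(2) by (auto simp: smult_r_distr[symmetric])
    show "a \<odot>\<^bsub>V\<^esub> b \<in> ?N" if "a \<in> carrier R" "b \<in> ?N" for a b
      using that by (auto simp: comm)
  qed (use assms(2) in auto)
  show ?thesis
    unfolding ring_mod_elem_def module_mod_elem_def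
    by (rule quot_module_module[OF assms(1) R.cgenideal_ideal[OF assms(2)] sub])
      (use assms(2) in \<open>auto simp: cgenideal_def smult_assoc1 comm\<close>)
qed

end

theory Submission
  imports Defs
begin

text \<open>
  If \<open>depth R = 0\<close> and \<open>R\<close> were not a field, conditions (3), (5) and (2) would contradict each other.
  If \<open>depth R > 0\<close>, prime avoidance yields a regular element \<open>x \<in> \<mm> - \<mm>\<^sup>2\<close> outside the finitely many
  exceptional primes, so \<open>R/xR\<close> inherits the hypotheses; and \<open>R\<close> is regular if \<open>R/xR\<close> is, because
  Krull's principal ideal theorem gives \<open>dim R = dim (R/xR) + 1\<close>.  The descent terminates since the
  kernels of the maps from the original ring to the successive quotients strictly increase.
\<close>

text \<open>All rings met in the descent have the element type of \<open>R\<close>, since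
  \<open>P\<close>, \<open>Q\<close> and \<open>le\<close> can only be applied there. This favours
  arguments inside a single ring: localisations are replaced by saturated ideals, and the successive
  quotients are treated as images of the original ring, whose ascending chain condition then bounds
  the descent. The dimension formula is split into two statements about chains of primes. A regular
  element lies in no minimal prime, so a chain of \<open>R/xR\<close>, pulled back, can be extended
  downwards; and Krull's theorem, applied along a chain of \<open>R\<close> ending in
  \<open>\<mm>\<close>, moves \<open>x\<close> into all its members at the cost of one. Taking
  \<open>x\<close> outside \<open>\<mm>\<^sup>2\<close> is dictated by conditions (1) and (4); that
  this leaves any choice is Nakayama's lemma for \<open>\<mm>\<close>, which is nonzero when the
  depth is positive.\<close>

context cring
begin

section \<open>Elementary facts on ideals\<close>

lemma ideal_intro:
  assumes "I \<subseteq> carrier R" "\<zero> \<in> I"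
    and add: "\<And>a b. a \<in> I \<Longrightarrow> b \<in> I \<Longrightarrow> a \<oplus> b \<in> I"
    and mult: "\<And>a c. a \<in> I \<Longrightarrow> c \<in> carrier R \<Longrightarrow> c \<otimes> a \<in> I"
  shows "ideal I R"
proof (rule idealI)
  have neg: "\<ominus> a \<in> I" if "a \<in> I" for a
    using mult[OF that, of "\<ominus> \<one>"] that assms(1) by (auto simp: l_minus)
  show "subgroup I (add_monoid R)"
    using assms(1,2) add neg by (intro add.subgroupI) (auto simp: a_inv_def)
  show "a \<otimes> x \<in> I" if "a \<in> I" "x \<in> carrier R" for a x
    using mult[OF that] that assms(1) m_comm by auto
qed (use mult ring_axioms in auto)

lemma mem_add_cgenideal:
  assumes "a \<in> carrier R"
  shows "b \<in> I <+> PIdl a \<longleftrightarrow> (\<exists>i\<in>I. \<exists>c\<in>carrier R. b = i \<oplus> c \<otimes> a)"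
  by (auto simp: set_add_def' cgenideal_def)

lemma subset_add_cgenideal:
  assumes "ideal I R" "a \<in> carrier R"
  shows "ideal (I <+> PIdl a) R" "I \<subseteq> I <+> PIdl a" "a \<in> I <+> PIdl a"
proof -
  interpret I: ideal I R by fact
  show "ideal (I <+> PIdl a) R"
    by (intro add_ideals assms cgenideal_ideal)
  show "I \<subseteq> I <+> PIdl a"
  proof
    fix b assume "b \<in> I"
    then have "b = b \<oplus> \<zero> \<otimes> a" using assms by simp
    then show "b \<in> I <+> PIdl a" using \<open>b \<in> I\<close> mem_add_cgenideal[OF assms(2)] by blast
  qed
  have "a = \<zero> \<oplus> \<one> \<otimes> a" using assms by simp
  then show "a \<in> I <+> PIdl a" 
    using mem_add_cgenideal[OF assms(2)] I.zero_closed by blast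
qed

lemma ideal_cancel:
  assumes "ideal I R" "a \<oplus> b \<in> I" "a \<in> I" "b \<in> carrier R"
  shows "b \<in> I"
proof -
  interpret I: ideal I R by fact
  have "\<ominus> a \<oplus> (a \<oplus> b) \<in> I"
    using I.a_closed[OF I.a_inv_closed[OF assms(3)] assms(2)] .
  moreover have "\<ominus> a \<oplus> (a \<oplus> b) = b"
    using I.Icarr[OF assms(3)] assms(4) by algebra
  ultimately show ?thesis by simp
qed

section \<open>Colon ideals and prime avoidance\<close>

text \<open>The annihilator of the class of \<open>b\<close> modulo \<open>I\<close>. With
  \<open>I = {\<zero>}\<close> it describes zero divisors, with general \<open>I\<close> the
  associated primes of the quotient.\<close>

definition colon :: "'a set \<Rightarrow> 'a \<Rightarrow> 'a set"
  where "colon I b = {x \<in> carrier R. b \<otimes> x \<in> I}"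

lemma colon_ideal:
  assumes "ideal I R" "b \<in> carrier R"
  shows "ideal (colon I b) R"
  unfolding colon_def by (rule ideal.helper_max_prime[OF assms(1) is_cring assms(2)])

text \<open>If \<open>x \<otimes> y\<close> lies in \<open>colon I a\<close> but \<open>y\<close>
  does not, then \<open>a \<otimes> y\<close> is a competitor outside \<open>I\<close> whose colon
  ideal contains both \<open>colon I a\<close> and \<open>x\<close>; maximality puts
  \<open>x\<close> into \<open>colon I a\<close>.\<close>

lemma maximal_colon_prime:
  assumes I: "ideal I R" and a: "a \<in> carrier R" "a \<notin> I"
    and max: "\<And>b. b \<in> carrier R \<Longrightarrow> b \<notin> I \<Longrightarrow> colon I a \<subseteq> colon I b \<Longrightarrow> colon I b = colon I a"
  shows "primeideal (colon I a) R"
proof (rule primeidealI[OF colon_ideal[OF I a(1)] is_cring])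
  show "carrier R \<noteq> colon I a"
  proof
    assume "carrier R = colon I a"
    then have "\<one> \<in> colon I a" using one_closed by blast
    then show False using a by (simp add: colon_def)
  qed
  fix x y assume xy: "x \<in> carrier R" "y \<in> carrier R" "x \<otimes> y \<in> colon I a"
  show "x \<in> colon I a \<or> y \<in> colon I a"
  proof (rule disjCI)
    assume "y \<notin> colon I a"
    then have nI: "a \<otimes> y \<notin> I" using xy by (simp add: colon_def)
    have "colon I a \<subseteq> colon I (a \<otimes> y)"
    proof
      fix z assume z: "z \<in> colon I a"
      then have "a \<otimes> z \<otimes> y \<in> I" "z \<in> carrier R"
        using ideal.I_r_closed[OF I] xy by (auto simp: colon_def)
      moreover from this have "a \<otimes> z \<otimes> y = a \<otimes> y \<otimes> z" using a xy by algebra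
      ultimately show "z \<in> colon I (a \<otimes> y)" by (simp add: colon_def)
    qed
    moreover have "x \<in> colon I (a \<otimes> y)"
      using xy a m_comm[of x y] by (simp add: colon_def m_assoc)
    ultimately show "x \<in> colon I a"
      using max[of "a \<otimes> y"] nI a xy by simp
  qed
qed

text \<open>Primality keeps a product of elements outside \<open>p\<close> outside \<open>p\<close>,
  so one factor from each ideal suffices.\<close>

lemma prime_avoids_Inter:
  assumes "finite F" "\<And>I. I \<in> F \<Longrightarrow> ideal I R \<and> \<not> I \<subseteq> p" "primeideal p R"
  shows "\<exists>y \<in> carrier R. y \<notin> p \<and> (\<forall>I\<in>F. y \<in> I)"
  using assms
proof (induction F)
  case empty
  then show ?case
    by (metis equalityI ideal.Icarr primeideal.axioms(1) primeideal.I_notcarr subsetI empty_iff)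
next
  case (insert I F)
  interpret p: primeideal p R by fact
  obtain y where y: "y \<in> carrier R" "y \<notin> p" "\<forall>I\<in>F. y \<in> I"
    using insert by blast
  obtain z where z: "z \<in> I" "z \<notin> p" using insert.prems by blast
  have I: "ideal I R" and F: "\<And>J. J \<in> F \<Longrightarrow> ideal J R" using insert.prems by auto
  have zc: "z \<in> carrier R" using ideal.Icarr[OF I z(1)] .
  have "y \<otimes> z \<notin> p" using p.I_prime y z zc by blast
  moreover have "y \<otimes> z \<in> I" using ideal.I_l_closed[OF I z(1) y(1)] .
  moreover have "y \<otimes> z \<in> J" if "J \<in> F" for J
    using ideal.I_r_closed[OF F[OF that]] y(3) that zc by blast
  ultimately show ?case using y zc by (intro bexI[of _ "y \<otimes> z"]) auto
qed

text \<open>The ideal \<open>J\<close> may be non-prime (it will be the square of the maximal ideal)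
  because every correction term is taken from \<open>J\<close> itself, so adding it does not change
  membership in \<open>J\<close>. Such terms exist because no prime of \<open>F\<close> contains
  \<open>J\<close>.\<close>

lemma prime_avoidance:
  assumes I: "ideal I R" and J: "ideal J R" "J \<subseteq> I" "\<not> I \<subseteq> J"
    and "finite F" "\<And>p. p \<in> F \<Longrightarrow> primeideal p R \<and> \<not> J \<subseteq> p"
  shows "\<exists>x \<in> I. x \<notin> J \<and> x \<notin> \<Union>F"
  using assms(5,6)
proof (induction F rule: finite_psubset_induct)
  case (psubset F)
  show ?case
  proof (cases "F = {}")
    case True
    then show ?thesis using J by blast
  next
    case False
    \<comment> \<open>By minimality no other member of \<open>F\<close> is contained in
      \<open>p\<close>, so some element lies in \<open>J\<close> and in all the others but not in
      \<open>p\<close>; adding it to \<open>x\<close> repairs only \<open>p\<close>.\<close>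
    obtain p where p: "p \<in> F" and min: "\<And>q. q \<in> F \<Longrightarrow> q \<subseteq> p \<Longrightarrow> q = p"
      using finite_has_minimal[OF psubset.hyps False] by metis
    obtain x where x: "x \<in> I" "x \<notin> J" "x \<notin> \<Union>(F - {p})"
      using psubset.IH[of "F - {p}"] p psubset.prems by blast
    show ?thesis
    proof (cases "x \<in> p")
      case False
      then show ?thesis using x by blast
    next
      case True
      have "\<exists>y \<in> carrier R. y \<notin> p \<and> (\<forall>I\<in>insert J (F - {p}). y \<in> I)"
        using psubset p min J
        by (intro prime_avoids_Inter) (auto simp: primeideal_def)
      then obtain y where y: "y \<in> carrier R" "y \<notin> p" "y \<in> J" "\<And>q. q \<in> F \<Longrightarrow> q \<noteq> p \<Longrightarrow> y \<in> q"
        by blast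
      have xc: "x \<in> carrier R" using ideal.Icarr[OF I x(1)] .
      have pi: "\<And>q. q \<in> F \<Longrightarrow> ideal q R" using psubset.prems by (auto simp: primeideal_def)
      have comm: "x \<oplus> y = y \<oplus> x" using a_comm xc y(1) .
      have "x \<oplus> y \<in> I"
        using I J(2) x y(3) by (auto simp: ideal_def additive_subgroup.a_closed)
      moreover have "x \<oplus> y \<notin> J"
        unfolding comm using ideal_cancel[OF J(1) _ y(3) xc] x by blast
      moreover have "x \<oplus> y \<notin> p"
        using ideal_cancel[OF pi[OF p] _ True y(1)] y(2) by blast
      moreover have "x \<oplus> y \<notin> q" if "q \<in> F" "q \<noteq> p" for q
        unfolding comm using ideal_cancel[OF pi[OF that(1)] _ y(4)[OF that] xc] x that by blast
      ultimately show ?thesis by blast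
    qed
  qed
qed

end

section \<open>Noetherian rings: associated primes and zero divisors\<close>

locale noetherian_cring = cring R + noetherian_ring R for R (structure)

sublocale noeth_local_ring \<subseteq> noetherian_cring ..

context noetherian_cring
begin

text \<open>Noetherian induction in the form used throughout: the union of a chain of ideals is
  itself a member of the chain, so Zorn's lemma applies inside any family.\<close>

lemma maximal_ideal_in_family:
  assumes "S \<noteq> {}" "\<And>I. I \<in> S \<Longrightarrow> ideal I R"
  shows "\<exists>M\<in>S. \<forall>I\<in>S. M \<subseteq> I \<longrightarrow> I = M"
proof (rule subset_Zorn_nonempty[OF assms(1)])
  fix C assume C: "C \<noteq> {}" "subset.chain S C"
  then have "subset.chain {I. ideal I R} C"
    using assms(2) by (auto simp: pred_on.chain_def)
  then have "\<Union>C \<in> C" by (rule ideal_chain_is_trivial[OF C(1)])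
  then show "\<Union>C \<in> S" using C(2) by (auto simp: pred_on.chain_def)
qed

text \<open>Existence of associated primes above a prescribed annihilator. The lower bound
  \<open>colon I b\<close> catches a given zero divisor; maximality is exported because the
  finiteness argument below compares annihilators.\<close>

lemma exists_maximal_colon:
  assumes I: "ideal I R" and b: "b \<in> carrier R" "b \<notin> I"
  obtains a where "a \<in> carrier R" "a \<notin> I" "colon I b \<subseteq> colon I a" "primeideal (colon I a) R"
    "\<And>c. c \<in> carrier R \<Longrightarrow> c \<notin> I \<Longrightarrow> colon I a \<subseteq> colon I c \<Longrightarrow> colon I c = colon I a"
proof -
  define S where "S = colon I ` {a \<in> carrier R. a \<notin> I \<and> colon I b \<subseteq> colon I a}"
  have "\<exists>M\<in>S. \<forall>I\<in>S. M \<subseteq> I \<longrightarrow> I = M"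
    using b colon_ideal[OF I] by (intro maximal_ideal_in_family) (auto simp: S_def)
  then obtain a where a: "a \<in> carrier R" "a \<notin> I" "colon I b \<subseteq> colon I a"
    and aS: "\<forall>J\<in>S. colon I a \<subseteq> J \<longrightarrow> J = colon I a"
    by (auto simp: S_def)
  have max: "colon I c = colon I a" if "c \<in> carrier R" "c \<notin> I" "colon I a \<subseteq> colon I c" for c
  proof -
    have "colon I c \<in> S" unfolding S_def using that a(3) by (intro imageI CollectI conjI) auto
    then show ?thesis using aS that(3) by simp
  qed
  show thesis
    by (rule that[OF a maximal_colon_prime[OF I a(1,2) max] max])
qed

text \<open>
  The primes are the maximal annihilators of nonzero elements.  There are finitely many: some
  finite set of the annihilated elements generates all the others, so each maximal annihilator
  contains an intersection of finitely many of them.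
\<close>

lemma zero_divisors_finite_union:
  obtains F where "finite F" "\<And>p. p \<in> F \<Longrightarrow> primeideal p R"
    "\<And>p x. p \<in> F \<Longrightarrow> x \<in> p \<Longrightarrow> \<not> regular_element R x"
    "\<And>x. x \<in> carrier R \<Longrightarrow> \<not> regular_element R x \<Longrightarrow> x \<in> \<Union>F"
proof -
  define T where "T = {a \<in> carrier R. a \<noteq> \<zero> \<and> primeideal (colon {\<zero>} a) R \<and>
    (\<forall>c\<in>carrier R. c \<noteq> \<zero> \<longrightarrow> colon {\<zero>} a \<subseteq> colon {\<zero>} c \<longrightarrow> colon {\<zero>} c = colon {\<zero>} a)}"
  have Tc: "T \<subseteq> carrier R" by (auto simp: T_def)
  have "\<exists>M\<in>{Idl A |A. finite A \<and> A \<subseteq> T}. \<forall>I\<in>{Idl A |A. finite A \<and> A \<subseteq> T}. M \<subseteq> I \<longrightarrow> I = M"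
    using Tc by (intro maximal_ideal_in_family) (auto intro!: genideal_ideal)
  then obtain A where A: "finite A" "A \<subseteq> T"
    and max: "\<And>B. finite B \<Longrightarrow> B \<subseteq> T \<Longrightarrow> Idl A \<subseteq> Idl B \<Longrightarrow> Idl B = Idl A"
    by (smt (verit, best) mem_Collect_eq)
  have gen: "t \<in> Idl A" if "t \<in> T" for t
  proof -
    have "Idl (insert t A) = Idl A"
      using A that Tc by (intro max subset_Idl_subset) auto
    then show ?thesis using genideal_self[of "insert t A"] A that Tc by auto
  qed
  have sub: "colon {\<zero>} t \<in> colon {\<zero>} ` A" if t: "t \<in> T" for t
  proof (rule ccontr)
    assume neg: "colon {\<zero>} t \<notin> colon {\<zero>} ` A"
    have tp: "primeideal (colon {\<zero>} t) R" "t \<in> carrier R" "t \<noteq> \<zero>" using t by (auto simp: T_def)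
    have "\<not> colon {\<zero>} a \<subseteq> colon {\<zero>} t" if "a \<in> A" for a
      using neg that t A by (auto simp: T_def)
    then have "\<exists>y \<in> carrier R. y \<notin> colon {\<zero>} t \<and> (\<forall>I\<in>colon {\<zero>} ` A. y \<in> I)"
      using A Tc by (intro prime_avoids_Inter tp) (auto intro!: colon_ideal zeroideal)
    then obtain y where y: "y \<in> carrier R" "y \<notin> colon {\<zero>} t" "\<And>a. a \<in> A \<Longrightarrow> y \<in> colon {\<zero>} a"
      by auto
    \<comment> \<open>Annihilation is symmetric: \<open>y\<close> kills every element of
      \<open>A\<close>, so \<open>A\<close> lies in the annihilator of \<open>y\<close>, an ideal
      that therefore contains all that \<open>A\<close> generates, including
      \<open>t\<close>.\<close>
    have "A \<subseteq> colon {\<zero>} y"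
      using y(1,3) A Tc by (auto simp: colon_def m_comm)
    then have "Idl A \<subseteq> colon {\<zero>} y"
      using y(1) by (intro genideal_minimal colon_ideal zeroideal) auto
    then have "t \<in> colon {\<zero>} y" using gen t by blast
    then show False using y(1,2) m_comm[of y t] by (simp add: colon_def)
  qed
  show thesis
  proof (rule that[of "colon {\<zero>} ` T"])
    show "finite (colon {\<zero>} ` T)"
      using sub A by (meson finite_imageI finite_subset image_subsetI)
    show "primeideal p R" if "p \<in> colon {\<zero>} ` T" for p using that by (auto simp: T_def)
    show "\<not> regular_element R x" if "p \<in> colon {\<zero>} ` T" "x \<in> p" for p x
      using that by (auto simp: T_def colon_def regular_element_def m_comm)
    show "x \<in> \<Union>(colon {\<zero>} ` T)" if x: "x \<in> carrier R" "\<not> regular_element R x" for x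
    proof -
      obtain b where b: "b \<in> carrier R" "b \<noteq> \<zero>" "x \<otimes> b = \<zero>"
        using x by (auto simp: regular_element_def)
      have xb: "x \<in> colon {\<zero>} b" using b x by (simp add: colon_def m_comm)
      obtain a where "a \<in> carrier R" "a \<notin> {\<zero>}" "colon {\<zero>} b \<subseteq> colon {\<zero>} a" "primeideal (colon {\<zero>} a) R"
        "\<And>c. c \<in> carrier R \<Longrightarrow> c \<notin> {\<zero>} \<Longrightarrow> colon {\<zero>} a \<subseteq> colon {\<zero>} c \<Longrightarrow> colon {\<zero>} c = colon {\<zero>} a"
        using exists_maximal_colon[OF zeroideal b(1)] b(2) by blast
      then have "a \<in> T" by (simp add: T_def)
      then show ?thesis using xb \<open>colon {\<zero>} b \<subseteq> colon {\<zero>} a\<close> by blast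
    qed
  qed
qed

end

section \<open>Krull's principal ideal theorem\<close>

context cring
begin

text \<open>
  An ideal is saturated at a prime \<open>r\<close> iff it is contracted from the localisation of the ring at
  \<open>r\<close>; working with saturated ideals avoids constructing the localisation.
\<close>

definition saturated :: "'a set \<Rightarrow> 'a set \<Rightarrow> bool"
  where "saturated r I \<longleftrightarrow> (\<forall>s \<in> carrier R - r. \<forall>a \<in> carrier R. s \<otimes> a \<in> I \<longrightarrow> a \<in> I)"

definition saturation :: "'a set \<Rightarrow> 'a set \<Rightarrow> 'a set"
  where "saturation r I = {a \<in> carrier R. \<exists>s \<in> carrier R - r. s \<otimes> a \<in> I}"

lemma saturatedD:
  "saturated r I \<Longrightarrow> s \<in> carrier R \<Longrightarrow> s \<notin> r \<Longrightarrow> a \<in> carrier R \<Longrightarrow> s \<otimes> a \<in> I \<Longrightarrow> a \<in> I"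
  by (auto simp: saturated_def)

lemma saturated_mono: "saturated q I \<Longrightarrow> q \<subseteq> r \<Longrightarrow> saturated r I"
  by (auto simp: saturated_def)

lemma prime_saturated:
  assumes "primeideal p R" "p \<subseteq> r"
  shows "saturated r p"
  using primeideal.I_prime[OF assms(1)] assms(2) by (auto simp: saturated_def)

lemma saturation_minimal:
  assumes "saturated r J" "I \<subseteq> J"
  shows "saturation r I \<subseteq> J"
  using assms by (auto simp: saturated_def saturation_def)

lemma saturation_mono: "I \<subseteq> J \<Longrightarrow> saturation r I \<subseteq> saturation r J"
  by (auto simp: saturation_def)

lemma prime_one_notin:
  assumes "primeideal r R"
  shows "\<one> \<notin> r"
  using ideal.one_imp_carrier primeideal.I_notcarr primeideal.axioms(1) assms by metis

context
  fixes r I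
  assumes r: "primeideal r R" and I: "ideal I R"
begin

interpretation r: primeideal r R by (rule r)
interpretation I: ideal I R by (rule I)

lemma subset_saturation: "I \<subseteq> saturation r I"
proof
  fix a assume "a \<in> I"
  moreover from this have "\<one> \<otimes> a \<in> I" using I.Icarr by simp
  ultimately show "a \<in> saturation r I"
    using prime_one_notin[OF r] I.Icarr unfolding saturation_def by blast
qed

lemma saturation_ideal: "ideal (saturation r I) R"
proof (rule ideal_intro)
  show "saturation r I \<subseteq> carrier R" by (auto simp: saturation_def)
  show "\<zero> \<in> saturation r I" using subset_saturation I.zero_closed by blast
  fix a c assume "a \<in> saturation r I" and c: "c \<in> carrier R"
  then obtain s where s: "s \<in> carrier R" "s \<notin> r" "s \<otimes> a \<in> I" "a \<in> carrier R"
    by (auto simp: saturation_def)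
  have "s \<otimes> (c \<otimes> a) = c \<otimes> (s \<otimes> a)" using s c by algebra
  then show "c \<otimes> a \<in> saturation r I"
    using s c I.I_l_closed[OF s(3) c] by (auto simp: saturation_def intro!: bexI[of _ s])
next
  fix a b assume "a \<in> saturation r I" "b \<in> saturation r I"
  then obtain s t where s: "s \<in> carrier R" "s \<notin> r" "s \<otimes> a \<in> I" "a \<in> carrier R"
    and t: "t \<in> carrier R" "t \<notin> r" "t \<otimes> b \<in> I" "b \<in> carrier R"
    by (auto simp: saturation_def)
  have "(s \<otimes> t) \<otimes> (a \<oplus> b) = t \<otimes> (s \<otimes> a) \<oplus> s \<otimes> (t \<otimes> b)" using s t by algebra
  also have "\<dots> \<in> I"
    using I.a_closed[OF I.I_l_closed[OF s(3) t(1)] I.I_l_closed[OF t(3) s(1)]] .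
  finally show "a \<oplus> b \<in> saturation r I"
    using s t r.I_prime[OF s(1) t(1)] by (auto simp: saturation_def intro!: bexI[of _ "s \<otimes> t"])
qed

lemma saturated_saturation: "saturated r (saturation r I)"
  unfolding saturated_def
proof (intro ballI impI)
  fix s a assume s: "s \<in> carrier R - r" and a: "a \<in> carrier R" and "s \<otimes> a \<in> saturation r I"
  then obtain t where t: "t \<in> carrier R" "t \<notin> r" "t \<otimes> (s \<otimes> a) \<in> I"
    by (auto simp: saturation_def)
  then show "a \<in> saturation r I"
    using s a r.I_prime[of t s] by (auto simp: saturation_def m_assoc intro!: bexI[of _ "t \<otimes> s"])
qed

end

end

section \<open>Descending chains and Nakayama's lemma at a prime\<close>

context noetherian_cring
begin

text \<open>
  If \<open>r\<close> is minimal over \<open>I\<^sub>0\<close>, the localisation of the quotient by \<open>I\<^sub>0\<close> at \<open>r\<close> is Artinian.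
  By noetherian induction the claim may be assumed above \<open>M + (a)\<close>, where \<open>r = (M : a)\<close> is
  associated to \<open>M\<close>, and a chain either contains \<open>a\<close> throughout or eventually avoids \<open>a\<close>.
\<close>

lemma saturated_dcc:
  assumes r: "primeideal r R" and I0: "ideal I\<^sub>0 R"
    and min: "\<And>p. primeideal p R \<Longrightarrow> I\<^sub>0 \<subseteq> p \<Longrightarrow> p \<subseteq> r \<Longrightarrow> p = r"
    and J: "\<And>n. ideal (J n) R" "\<And>n. saturated r (J n)" "\<And>n. I\<^sub>0 \<subseteq> J n" "\<And>n. J (Suc n) \<subseteq> J n"
  shows "\<exists>N. \<forall>n\<ge>N. J n = J N"
proof (rule ccontr)
  define chain where "chain I K \<longleftrightarrow>
    (\<forall>n. ideal (K n) R \<and> saturated r (K n) \<and> I \<subseteq> K n \<and> K (Suc n) \<subseteq> K n)" for I and K :: "nat \<Rightarrow> 'a set"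
  define stable where "stable K \<longleftrightarrow> (\<exists>N. \<forall>n\<ge>N. K n = K N)" for K :: "nat \<Rightarrow> 'a set"
  define S where "S = {I. ideal I R \<and> saturated r I \<and> I\<^sub>0 \<subseteq> I \<and> (\<exists>K. chain I K \<and> \<not> stable K)}"
  assume "\<nexists>N. \<forall>n\<ge>N. J n = J N"
  then have "\<not> stable J" by (simp add: stable_def)
  moreover have "chain (saturation r I\<^sub>0) J"
    using J saturation_minimal by (auto simp: chain_def)
  ultimately have "saturation r I\<^sub>0 \<in> S"
    using saturation_ideal[OF r I0] saturated_saturation[OF r I0] subset_saturation[OF r I0]
    by (auto simp: S_def)
  then have "\<exists>M\<in>S. \<forall>I\<in>S. M \<subseteq> I \<longrightarrow> I = M"
    by (intro maximal_ideal_in_family) (auto simp: S_def)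
  then obtain M K where M: "ideal M R" "saturated r M" "I\<^sub>0 \<subseteq> M" and chK: "chain M K" and nst: "\<not> stable K"
    and max: "\<And>I. I \<in> S \<Longrightarrow> M \<subseteq> I \<Longrightarrow> I = M"
    unfolding S_def by auto
  have K: "ideal (K n) R" "saturated r (K n)" "M \<subseteq> K n" "K (Suc n) \<subseteq> K n" for n
    using chK by (auto simp: chain_def)
  have anti: "K n \<subseteq> K m" if "m \<le> n" for m n
    using lift_Suc_antimono_le[of K, OF K(4) that] .
  have "M \<noteq> carrier R"
  proof
    assume "M = carrier R"
    then have "K n = carrier R" for n using K(3)[of n] ideal.Icarr[OF K(1)] by blast
    then show False using nst by (simp add: stable_def)
  qed
  then obtain b where b: "b \<in> carrier R" "b \<notin> M" using ideal.Icarr[OF M(1)] by blast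
  obtain a where a: "a \<in> carrier R" "a \<notin> M" "primeideal (colon M a) R"
    using exists_maximal_colon[OF M(1) b] by metis
  \<comment> \<open>As \<open>M\<close> is saturated at \<open>r\<close> and \<open>a\<close> is
    outside \<open>M\<close>, no element outside \<open>r\<close> multiplies \<open>a\<close> into
    \<open>M\<close>. So \<open>colon M a\<close> is a prime between \<open>I\<^sub>0\<close> and
    \<open>r\<close>, hence equal to \<open>r\<close>.\<close>
  have "M \<subseteq> colon M a"
    using ideal.I_l_closed[OF M(1)] ideal.Icarr[OF M(1)] a(1) by (auto simp: colon_def)
  moreover have "colon M a \<subseteq> r"
    using saturatedD[OF M(2) _ _ a(1)] a(2) m_comm[OF a(1)] by (fastforce simp: colon_def)
  ultimately have "colon M a = r"
    using min[OF a(3)] M(3) by blast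
  then have ra: "c \<otimes> a \<in> M" if "c \<in> r" for c
    using that a(1) by (auto simp: colon_def m_comm)

  define ext where "ext I = saturation r (I <+> PIdl a)" for I
  have ext: "ideal (ext I) R" "saturated r (ext I)" "I \<subseteq> ext I" "a \<in> ext I" if "ideal I R" for I
    using subset_add_cgenideal[OF that a(1)] saturation_ideal[OF r] saturated_saturation[OF r]
      subset_saturation[OF r] unfolding ext_def by blast+
  have ext_min: "ext I \<subseteq> L" if "I \<subseteq> L" "a \<in> L" "saturated r L" "ideal L R" for I L
    unfolding ext_def
  proof (rule saturation_minimal[OF that(3)])
    show "I <+> PIdl a \<subseteq> L"
      using subsetD[OF that(1)] that(2) ideal.I_l_closed[OF that(4)] additive_subgroup.a_closed[OF ideal.axioms(1)[OF that(4)]]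
      by (auto simp: mem_add_cgenideal[OF a(1)])
  qed
  have "ext M \<noteq> M" using ext(4)[OF M(1)] a(2) by blast
  then have "ext M \<notin> S" using max ext(3)[OF M(1)] by blast
  then have stab: "stable L" if "chain (ext M) L" for L
    using that ext[OF M(1)] M(3) unfolding S_def by blast

  show False
  proof (cases "\<forall>n. a \<in> K n")
    case True
    then have "chain (ext M) K"
      using K ext_min by (auto simp: chain_def)
    then show False using stab nst by blast
  next
    case False
    then obtain N where N: "a \<notin> K N" by blast
    have "chain (ext M) (\<lambda>n. ext (K n))"
      unfolding chain_def
    proof (intro allI conjI)
      fix n
      show "ext M \<subseteq> ext (K n)" "ext (K (Suc n)) \<subseteq> ext (K n)"
        using K(3,4)[of n] ext[OF K(1), of n] by (intro ext_min; blast)+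
    qed (use ext K in auto)
    then obtain N' where N': "\<And>n. n \<ge> N' \<Longrightarrow> ext (K n) = ext (K N')"
      using stab unfolding stable_def by blast
    define m where "m = max N N'"
    have am: "a \<notin> K m" using N anti[of N m] by (auto simp: m_def)
    have "K m \<subseteq> K n" if mn: "m \<le> n" for n
    proof
      fix b assume bm: "b \<in> K m"
      then have "b \<in> ext (K n)"
        using ext(3)[OF K(1)] N'[of m] N'[of n] mn by (auto simp: m_def)
      then obtain s where s: "s \<in> carrier R" "s \<notin> r" "s \<otimes> b \<in> K n <+> PIdl a" and bc: "b \<in> carrier R"
        by (auto simp: ext_def saturation_def)
      then obtain j c where j: "j \<in> K n" and c: "c \<in> carrier R" and eq: "s \<otimes> b = j \<oplus> c \<otimes> a"
        by (auto simp: mem_add_cgenideal[OF a(1)])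
      \<comment> \<open>As \<open>a\<close> is outside the saturated \<open>K m\<close>, the
        coefficient \<open>c\<close> must lie in \<open>r\<close>; then \<open>c \<otimes> a\<close>
        is already in \<open>M\<close>, hence in every \<open>K n\<close>.\<close>
      have "c \<otimes> a \<in> K m"
      proof (rule ideal_cancel[OF K(1)])
        show "j \<oplus> c \<otimes> a \<in> K m" using ideal.I_l_closed[OF K(1) bm s(1)] eq by simp
        show "j \<in> K m" using j anti[OF mn] by blast
      qed (use a c in simp)
      then have "c \<in> r" using saturatedD[OF K(2)] am c a(1) by blast
      then have "s \<otimes> b \<in> K n"
        using subsetD[OF K(3)[of n] ra] j additive_subgroup.a_closed[OF ideal.axioms(1)[OF K(1)]] eq by auto
      then show "b \<in> K n" using saturatedD[OF K(2)] s bc by blast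
    qed
    then have "\<forall>n\<ge>m. K n = K m" using anti by blast
    then show False using nst unfolding stable_def by blast
  qed
qed

text \<open>Nakayama's lemma for the localisation at \<open>r\<close> of the quotient of
  \<open>B\<close> by \<open>A\<close>. If \<open>A \<noteq> B\<close>, a maximal saturated ideal
  \<open>L\<close> with \<open>A \<subseteq> L \<subset> B\<close> leaves a locally simple quotient
  of \<open>B\<close>, which \<open>r\<close> annihilates; then \<open>ex\<close> pushes all of
  \<open>B\<close> into \<open>L\<close>.\<close>

lemma saturated_nakayama:
  assumes r: "primeideal r R" and A: "ideal A R" "saturated r A" and B: "ideal B R" "saturated r B"
    and AB: "A \<subseteq> B"
    and ex: "\<And>b. b \<in> B \<Longrightarrow> \<exists>s \<in> carrier R - r. s \<otimes> b \<in> A <+> ideal_prod R r B"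
  shows "A = B"
proof (rule ccontr)
  interpret r: primeideal r R by (rule r)
  assume "A \<noteq> B"
  define S where "S = {L. ideal L R \<and> saturated r L \<and> A \<subseteq> L \<and> L \<subset> B}"
  have "A \<in> S" using A AB \<open>A \<noteq> B\<close> by (auto simp: S_def)
  then have "\<exists>M\<in>S. \<forall>I\<in>S. M \<subseteq> I \<longrightarrow> I = M"
    by (intro maximal_ideal_in_family) (auto simp: S_def)
  then obtain L where L: "ideal L R" "saturated r L" "A \<subseteq> L" "L \<subset> B"
    and max: "\<And>I. I \<in> S \<Longrightarrow> L \<subseteq> I \<Longrightarrow> I = L"
    unfolding S_def by auto
  interpret L: ideal L R by (rule L)
  interpret B: ideal B R by (rule B)
  have yb: "y \<otimes> b \<in> L" if y: "y \<in> r" and b: "b \<in> B" for y b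
  proof (rule ccontr)
    assume nL: "y \<otimes> b \<notin> L"
    have yc: "y \<in> carrier R" and bc: "b \<in> carrier R" using y b r.Icarr B.Icarr by auto
    have ybc: "y \<otimes> b \<in> carrier R" using yc bc by simp
    define L' where "L' = saturation r (L <+> PIdl (y \<otimes> b))"
    note add = subset_add_cgenideal[OF L(1) ybc]
    have L': "ideal L' R" "saturated r L'" "L <+> PIdl (y \<otimes> b) \<subseteq> L'"
      unfolding L'_def using saturation_ideal[OF r add(1)] saturated_saturation[OF r add(1)]
        subset_saturation[OF r add(1)] by auto
    have "L' \<subseteq> B"
      unfolding L'_def
    proof (rule saturation_minimal[OF B(2)])
      show "L <+> PIdl (y \<otimes> b) \<subseteq> B"
        using L(4) b yc by (auto simp: mem_add_cgenideal[OF ybc] intro!: B.a_closed B.I_l_closed)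
    qed
    moreover have "L' \<notin> S" using max[of L'] nL add L'(3) by blast
    ultimately have "L' = B" using L' L(3) add(2) unfolding S_def by blast
    then have "b \<in> L'" using b by simp
    then obtain s l c where s: "s \<in> carrier R" "s \<notin> r" and l: "l \<in> L" and c: "c \<in> carrier R"
      and eq: "s \<otimes> b = l \<oplus> c \<otimes> (y \<otimes> b)"
      by (auto simp: L'_def saturation_def mem_add_cgenideal[OF ybc])
    \<comment> \<open>With denominators cleared, \<open>s \<ominus> c \<otimes> y\<close> is the
      unit of the usual argument: \<open>s\<close> is outside \<open>r\<close> and \<open>y\<close>
      inside, so the difference is outside \<open>r\<close> and can be cancelled.\<close>
    have "(s \<ominus> c \<otimes> y) \<otimes> b = s \<otimes> b \<ominus> c \<otimes> (y \<otimes> b)" using s c yc bc by algebra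
    also have "\<dots> = l" unfolding eq using c yc bc L.Icarr[OF l] by algebra
    finally have "(s \<ominus> c \<otimes> y) \<otimes> b \<in> L" using l by simp
    moreover have "s \<ominus> c \<otimes> y \<notin> r"
    proof
      assume "s \<ominus> c \<otimes> y \<in> r"
      then have "(s \<ominus> c \<otimes> y) \<oplus> c \<otimes> y \<in> r" using r.I_l_closed[OF y c] r.a_closed by blast
      moreover have "(s \<ominus> c \<otimes> y) \<oplus> c \<otimes> y = s" using s c yc by algebra
      ultimately show False using s by simp
    qed
    moreover have "s \<ominus> c \<otimes> y \<in> carrier R" using s c yc by simp
    ultimately have "b \<in> L" using saturatedD[OF L(2) _ _ bc] by blast
    then show False using nL L.I_l_closed yc by blast
  qed
  have "ideal_prod R r B \<subseteq> L"
  proof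
    fix z assume "z \<in> ideal_prod R r B"
    then show "z \<in> L" by induction (auto intro: yb L.a_closed)
  qed
  then have "A <+> ideal_prod R r B \<subseteq> L" using L(3) by (auto simp: set_add_def' intro: L.a_closed)
  then have "B \<subseteq> L" using ex saturatedD[OF L(2)] B.Icarr by blast
  then show False using L(4) by blast
qed

text \<open>
  \<open>B n\<close> is the \<open>n\<close>-th symbolic power of \<open>q\<close> modulo \<open>p\<close>.  If \<open>r\<close> were minimal over \<open>p + (x)\<close>, the
  chain \<open>B n + (x)\<close> would stabilise at \<open>r\<close>, and then Nakayama's lemma at \<open>r\<close> and at \<open>q\<close> would
  give \<open>B n = B (n + 1)\<close> and \<open>B n = p\<close>.
\<close>

lemma prime_between_containing:
  assumes p: "primeideal p R" and q: "primeideal q R" and r: "primeideal r R"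
    and pq: "p \<subset> q" and qr: "q \<subset> r" and x: "x \<in> r"
  shows "\<exists>p'. primeideal p' R \<and> p \<subset> p' \<and> p' \<subset> r \<and> x \<in> p'"
proof (rule ccontr)
  assume neg: "\<not> ?thesis"
  have xq: "x \<notin> q" using neg q pq qr by blast
  interpret p: primeideal p R by (rule p)
  interpret q: primeideal q R by (rule q)
  interpret r: primeideal r R by (rule r)
  have xc: "x \<in> carrier R" using r.Icarr[OF x] .
  note ix = subset_add_cgenideal[OF _ xc]
  have min: "p' = r" if "primeideal p' R" "p <+> PIdl x \<subseteq> p'" "p' \<subseteq> r" for p' :: "'a set"
    using neg that ix[OF p.is_ideal] xq pq by blast
  define B where "B = rec_nat (carrier R) (\<lambda>_ (I :: 'a set). saturation q (p <+> ideal_prod R q I))"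
  have B0: "B 0 = carrier R" and BS: "B (Suc n) = saturation q (p <+> ideal_prod R q (B n))" for n
    by (simp_all add: B_def)
  have B: "ideal (B n) R" "saturated q (B n)" for n
  proof (induction n)
    case 0
    show "ideal (B 0) R" by (simp add: B0 oneideal)
    show "saturated q (B 0)" by (simp add: B0 saturated_def)
  next
    case (Suc n)
    have "ideal (p <+> ideal_prod R q (B n)) R"
      by (intro add_ideals ideal_prod_is_ideal Suc p.is_ideal q.is_ideal)
    then show "ideal (B (Suc n)) R" "saturated q (B (Suc n))"
      unfolding BS by (rule saturation_ideal[OF q], rule saturated_saturation[OF q])
  qed
  have step: "p <+> ideal_prod R q (B n) \<subseteq> B (Suc n)" for n
    unfolding BS by (intro subset_saturation q add_ideals ideal_prod_is_ideal B p.is_ideal q.is_ideal)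
  have pl: "p \<subseteq> p <+> I" and pr: "I \<subseteq> p <+> I" if "ideal I R" for I :: "'a set"
    using union_genideal[OF p.is_ideal that] genideal_self[of "p \<union> I"] p.a_subset ideal.Icarr[OF that] by blast+
  have pB: "p \<subseteq> B n" for n
  proof (cases n)
    case (Suc m)
    then show ?thesis using step pl[OF ideal_prod_is_ideal[OF q.is_ideal B(1)]] by blast
  qed (use p.a_subset B0 in simp)
  have dec: "B (Suc n) \<subseteq> B n" for n
    unfolding BS
  proof (rule saturation_minimal[OF B(2)])
    show "p <+> ideal_prod R q (B n) \<subseteq> B n"
      using subsetD[OF pB[of n]] subsetD[OF ideal_prod_inter[OF q.is_ideal B(1), of n]]
      by (auto simp: set_add_def' intro!: additive_subgroup.a_closed[OF ideal.axioms(1)[OF B(1)]])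
  qed
  define J where "J n = saturation r (B n <+> PIdl x)" for n
  have BJ: "B n <+> PIdl x \<subseteq> J n" for n
    unfolding J_def by (rule subset_saturation[OF r ix(1)[OF B(1)]])
  have mono: "set_add R I (PIdl x) \<subseteq> set_add R I' (PIdl x)" if "I \<subseteq> I'" for I I'
    using that by (auto simp: set_add_def')
  have "\<exists>N. \<forall>n\<ge>N. J n = J N"
  proof (rule saturated_dcc[OF r ix(1)[OF p.is_ideal] min])
    show "ideal (J n) R" "saturated r (J n)" for n
      unfolding J_def by (rule saturation_ideal[OF r ix(1)[OF B(1)]], rule saturated_saturation[OF r ix(1)[OF B(1)]])
    show "p <+> PIdl x \<subseteq> J n" for n using mono[OF pB] BJ by blast
    show "J (Suc n) \<subseteq> J n" for n
      unfolding J_def by (intro saturation_mono mono dec)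
  qed
  then obtain N where N: "J N = J (Suc N)" by (metis le_SucI order_refl)
  have "B (Suc N) = B N"
  proof (rule saturated_nakayama[OF r B(1) _ B(1) _ dec])
    show "saturated r (B n)" for n using saturated_mono[OF B(2)] qr by blast
    then show "saturated r (B n)" for n .
    fix b assume b: "b \<in> B N"
    then have "b \<in> J (Suc N)" using ix(2)[OF B(1)] BJ N by blast
    then obtain s c d where s: "s \<in> carrier R" "s \<notin> r" and c: "c \<in> B (Suc N)" and d: "d \<in> carrier R"
      and eq: "s \<otimes> b = c \<oplus> d \<otimes> x"
      by (auto simp: J_def saturation_def mem_add_cgenideal[OF xc])
    \<comment> \<open>Since \<open>x\<close> is outside \<open>q\<close> and \<open>B N\<close> is
      saturated at \<open>q\<close>, the factor \<open>x\<close> can be cancelled. So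
      \<open>d\<close> lies in \<open>B N\<close>, and \<open>x \<otimes> d\<close> in the product
      of \<open>r\<close> and \<open>B N\<close>.\<close>
    have "x \<otimes> d \<in> B N"
    proof (rule ideal_cancel[OF B(1)])
      show "c \<oplus> x \<otimes> d \<in> B N"
        using ideal.I_l_closed[OF B(1) b s(1)] eq m_comm[OF xc d] by simp
      show "c \<in> B N" using c dec by blast
    qed (use xc d in simp)
    then have "d \<in> B N" using saturatedD[OF B(2) xc xq d] by blast
    then have "x \<otimes> d \<in> ideal_prod R r (B N)" using x by (intro ideal_prod.prod)
    then have "s \<otimes> b \<in> B (Suc N) <+> ideal_prod R r (B N)"
      using c eq m_comm[OF xc d] by (auto simp: set_add_def')
    then show "\<exists>s \<in> carrier R - r. s \<otimes> b \<in> B (Suc N) <+> ideal_prod R r (B N)" using s by blast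
  qed
  have "p = B N"
  proof (rule saturated_nakayama[OF q p.is_ideal prime_saturated[OF p] B pB])
    show "p \<subseteq> q" using pq by blast
    fix b assume "b \<in> B N"
    then have "b \<in> B (Suc N)" using \<open>B (Suc N) = B N\<close> by simp
    then show "\<exists>s \<in> carrier R - q. s \<otimes> b \<in> p <+> ideal_prod R q (B N)"
      by (simp add: BS saturation_def)
  qed
  \<comment> \<open>No symbolic power shrinks to \<open>p\<close>: multiplying an element of
    \<open>B n\<close> outside \<open>p\<close> by \<open>t\<close> gives an element of
    \<open>B (Suc n)\<close>, still outside \<open>p\<close> by primality.\<close>
  obtain t where t: "t \<in> q" "t \<notin> p" using pq by blast
  have "B n \<noteq> p" for n
  proof (induction n)
    case 0
    then show ?case using p.I_notcarr B0 by simp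
  next
    case (Suc n)
    then obtain b where b: "b \<in> B n" "b \<notin> p" using pB by blast
    have bc: "b \<in> carrier R" and tc: "t \<in> carrier R" using ideal.Icarr[OF B(1) b(1)] q.Icarr t by auto
    have "t \<otimes> b \<in> ideal_prod R q (B n)" using t(1) b(1) by (intro ideal_prod.prod)
    then have "t \<otimes> b \<in> B (Suc n)" using step pr[OF ideal_prod_is_ideal[OF q.is_ideal B(1)]] by blast
    then show ?case using p.I_prime[OF tc bc] t b by blast
  qed
  then show False using \<open>p = B N\<close> by blast
qed

end

section \<open>Chains of primes\<close>

definition prime_chain :: "('a, 'b) ring_scheme \<Rightarrow> nat \<Rightarrow> (nat \<Rightarrow> 'a set) \<Rightarrow> bool"
  where "prime_chain R n p \<longleftrightarrow> (\<forall>i \<le> n. primeideal (p i) R) \<and> (\<forall>i < n. p i \<subset> p (Suc i))"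

context noetherian_cring
begin

text \<open>\<open>prime_between_containing\<close> pushes \<open>x\<close> down the chain one prime
  at a time, starting below the top, until two primes are left and the bottom one is dropped.
  Keeping track of the top prime lets the induction glue the shortened lower part to the
  rest.\<close>

lemma prime_chain_containing:
  assumes "prime_chain R (Suc n) p" "x \<in> p (Suc n)"
  shows "\<exists>q. prime_chain R n q \<and> (\<forall>i\<le>n. x \<in> q i) \<and> q n = p (Suc n)"
  using assms
proof (induction n arbitrary: p)
  case 0
  then show ?case by (intro exI[of _ "\<lambda>_. p 1"]) (auto simp: prime_chain_def)
next
  case (Suc n)
  have "\<exists>p'. primeideal p' R \<and> p n \<subset> p' \<and> p' \<subset> p (Suc (Suc n)) \<and> x \<in> p'"
    using Suc.prems by (intro prime_between_containing[of _ "p (Suc n)"]) (auto simp: prime_chain_def)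
  then obtain p' where p': "primeideal p' R" "p n \<subset> p'" "p' \<subset> p (Suc (Suc n))" "x \<in> p'"
    by blast
  have "prime_chain R (Suc n) (p(Suc n := p'))"
    using Suc.prems(1) p' by (auto simp: prime_chain_def less_Suc_eq)
  from Suc.IH[OF this] obtain q where q: "prime_chain R n q" "\<forall>i\<le>n. x \<in> q i" "q n = p'"
    using p'(4) by (auto simp del: fun_upd_apply simp: fun_upd_same)
  have "prime_chain R (Suc n) (q(Suc n := p (Suc (Suc n))))"
    using q Suc.prems(1) p' by (auto simp: prime_chain_def less_Suc_eq le_Suc_eq)
  moreover have "\<forall>i\<le>Suc n. x \<in> (q(Suc n := p (Suc (Suc n)))) i"
    using q(2) Suc.prems(2) by (auto simp: le_Suc_eq)
  ultimately show ?case by (metis fun_upd_same)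
qed

text \<open>Take \<open>M\<close> maximal among the ideals missing \<open>T\<close>. If
  \<open>a\<close> and \<open>b\<close> are outside \<open>M\<close>, enlarging \<open>M\<close> by
  either one meets \<open>T\<close>; the product of the two elements found lies in \<open>T\<close>,
  and also in \<open>M\<close> as soon as \<open>a \<otimes> b\<close> does.\<close>

lemma exists_prime_disjoint:
  assumes T: "T \<subseteq> carrier R" "\<one> \<in> T" "\<zero> \<notin> T" "\<And>s t. s \<in> T \<Longrightarrow> t \<in> T \<Longrightarrow> s \<otimes> t \<in> T"
  shows "\<exists>p. primeideal p R \<and> p \<inter> T = {}"
proof -
  have "\<exists>M\<in>{I. ideal I R \<and> I \<inter> T = {}}. \<forall>I\<in>{I. ideal I R \<and> I \<inter> T = {}}. M \<subseteq> I \<longrightarrow> I = M"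
    using T(3) zeroideal by (intro maximal_ideal_in_family) auto
  then obtain M where M: "ideal M R" "M \<inter> T = {}"
    and max: "\<And>I. ideal I R \<Longrightarrow> I \<inter> T = {} \<Longrightarrow> M \<subseteq> I \<Longrightarrow> I = M"
    by auto
  interpret M: ideal M R by (rule M)
  have "primeideal M R"
  proof (rule primeidealI[OF M(1) is_cring])
    show "carrier R \<noteq> M" using M(2) T(2) one_closed by blast
    fix a b assume ab: "a \<in> carrier R" "b \<in> carrier R" "a \<otimes> b \<in> M"
    have meets: "\<exists>m\<in>M. \<exists>c\<in>carrier R. m \<oplus> c \<otimes> d \<in> T" if d: "d \<in> carrier R" "d \<notin> M" for d
    proof (rule ccontr)
      assume neg: "\<not> ?thesis"
      note add = subset_add_cgenideal[OF M(1) d(1)]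
      have "(M <+> PIdl d) \<inter> T = {}" using neg by (auto simp: mem_add_cgenideal[OF d(1)])
      then show False using max[OF add(1) _ add(2)] add(3) d(2) by blast
    qed
    show "a \<in> M \<or> b \<in> M"
    proof (rule ccontr)
      assume "\<not> (a \<in> M \<or> b \<in> M)"
      then obtain m c n d where m: "m \<in> M" "c \<in> carrier R" "m \<oplus> c \<otimes> a \<in> T"
        and n: "n \<in> M" "d \<in> carrier R" "n \<oplus> d \<otimes> b \<in> T"
        using meets ab by metis
      have mn: "m \<in> carrier R" "n \<in> carrier R" using m n M.Icarr by auto
      have "(m \<oplus> c \<otimes> a) \<otimes> (n \<oplus> d \<otimes> b) =
        ((n \<oplus> d \<otimes> b) \<otimes> m \<oplus> (c \<otimes> a) \<otimes> n) \<oplus> (c \<otimes> d) \<otimes> (a \<otimes> b)"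
        using mn m(2) n(2) ab by algebra
      also have "\<dots> \<in> M"
      proof -
        have "(n \<oplus> d \<otimes> b) \<otimes> m \<in> M" using mn n(2) ab by (intro M.I_l_closed m) auto
        moreover have "(c \<otimes> a) \<otimes> n \<in> M" using m(2) ab by (intro M.I_l_closed n) auto
        moreover have "(c \<otimes> d) \<otimes> (a \<otimes> b) \<in> M" using m(2) n(2) by (intro M.I_l_closed ab) auto
        ultimately show ?thesis by (intro M.a_closed)
      qed
      finally show False using T(4)[OF m(3) n(3)] M(2) by blast
    qed
  qed
  then show ?thesis using M(2) by blast
qed

text \<open>Powers of \<open>x\<close> times elements outside \<open>p\<close> form a multiplicative
  set, which misses zero because \<open>x\<close> is regular. A prime disjoint from it omits
  \<open>x\<close> and everything outside \<open>p\<close>.\<close>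

lemma exists_prime_avoiding_regular:
  assumes p: "primeideal p R" and x: "regular_element R x"
  shows "\<exists>q. primeideal q R \<and> q \<subseteq> p \<and> x \<notin> q"
proof -
  interpret p: primeideal p R by (rule p)
  have xc: "x \<in> carrier R" using x by (simp add: regular_element_def)
  define T where "T = {x [^] k \<otimes> s | (k :: nat) s. s \<in> carrier R - p}"
  have pow: "x [^] k \<otimes> s = \<zero> \<Longrightarrow> s = \<zero>" if "s \<in> carrier R" for k :: nat and s
  proof (induction k)
    case (Suc k)
    have "x \<otimes> (x [^] k \<otimes> s) = \<zero>" using Suc.prems xc that by (simp add: m_ac)
    moreover have "x [^] k \<otimes> s \<in> carrier R" using xc that by simp
    ultimately have "x [^] k \<otimes> s = \<zero>" using x unfolding regular_element_def by blast
    then show ?case by (rule Suc.IH)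
  qed (use that in simp)
  have "\<exists>q. primeideal q R \<and> q \<inter> T = {}"
  proof (rule exists_prime_disjoint)
    show "T \<subseteq> carrier R" using xc by (auto simp: T_def)
    have "\<one> = x [^] (0::nat) \<otimes> \<one>" by simp
    then show "\<one> \<in> T" using prime_one_notin[OF p] unfolding T_def by blast
    show "\<zero> \<notin> T"
    proof
      assume "\<zero> \<in> T"
      then obtain k :: nat and s where s: "s \<in> carrier R" "s \<notin> p" "x [^] k \<otimes> s = \<zero>"
        by (auto simp: T_def)
      then show False using pow[OF s(1,3)] p.zero_closed by simp
    qed
    fix u v assume "u \<in> T" "v \<in> T"
    then obtain j k :: nat and s t where s: "s \<in> carrier R" "s \<notin> p" "u = x [^] j \<otimes> s"
      and t: "t \<in> carrier R" "t \<notin> p" "v = x [^] k \<otimes> t"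
      by (auto simp: T_def)
    have "u \<otimes> v = x [^] (j + k) \<otimes> (s \<otimes> t)"
      using s t xc by (simp add: nat_pow_mult[symmetric] m_ac)
    then show "u \<otimes> v \<in> T" using s t p.I_prime[of s t] unfolding T_def by blast
  qed
  then obtain q where q: "primeideal q R" "q \<inter> T = {}" by blast
  interpret q: primeideal q R by (rule q)
  have "a \<in> T" if "a \<in> carrier R" "a \<notin> p" for a
  proof -
    have "a = x [^] (0::nat) \<otimes> a" using that by simp
    then show ?thesis using that unfolding T_def by blast
  qed
  then have "q \<subseteq> p" using q(2) q.Icarr by blast
  moreover have "x = x [^] (1::nat) \<otimes> \<one>" using xc by simp
  then have "x \<in> T" using prime_one_notin[OF p] unfolding T_def by blast
  ultimately show ?thesis using q by blast
qed

end

section \<open>Local rings\<close>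

context noeth_local_ring
begin

lemma max_ideal_maximal: "maximalideal (max_ideal R) R"
  unfolding max_ideal_def by (rule theI'[OF unique_maximal])

lemma max_ideal_prime: "primeideal (max_ideal R) R"
  by (rule maximalideal_prime[OF max_ideal_maximal])

lemma max_ideal_ideal: "ideal (max_ideal R) R"
  using max_ideal_maximal by (rule maximalideal.axioms)

lemma proper_ideal_subset_max_ideal:
  assumes I: "ideal I R" "I \<noteq> carrier R"
  shows "I \<subseteq> max_ideal R"
proof -
  have "\<exists>M\<in>{J. ideal J R \<and> J \<noteq> carrier R \<and> I \<subseteq> J}. \<forall>J\<in>{J. ideal J R \<and> J \<noteq> carrier R \<and> I \<subseteq> J}. M \<subseteq> J \<longrightarrow> J = M"
    using I by (intro maximal_ideal_in_family) auto
  then obtain M where M: "ideal M R" "M \<noteq> carrier R" "I \<subseteq> M"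
    and max: "\<And>J. ideal J R \<Longrightarrow> J \<noteq> carrier R \<Longrightarrow> I \<subseteq> J \<Longrightarrow> M \<subseteq> J \<Longrightarrow> J = M"
    by (smt (verit, best) mem_Collect_eq)
  have "maximalideal M R"
    using M max by (intro maximalidealI) blast+
  then show ?thesis using unique_maximal max_ideal_maximal M(3) by blast
qed

lemma prime_subset_max_ideal: "primeideal p R \<Longrightarrow> p \<subseteq> max_ideal R"
  by (metis primeideal.axioms(1) primeideal.I_notcarr proper_ideal_subset_max_ideal)

lemma max_ideal_one_notin: "\<one> \<notin> max_ideal R"
  by (rule prime_one_notin[OF max_ideal_prime])

lemma saturated_max_ideal_zero: "saturated (max_ideal R) {\<zero>}"
  unfolding saturated_def
proof (intro ballI impI)
  fix s a assume s: "s \<in> carrier R - max_ideal R" and a: "a \<in> carrier R" and sa: "s \<otimes> a \<in> {\<zero>}"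
  have "PIdl s = carrier R"
    using proper_ideal_subset_max_ideal[OF cgenideal_ideal, of s] cgenideal_self[of s] s by blast
  then obtain c where c: "c \<in> carrier R" "\<one> = c \<otimes> s"
    using one_closed by (auto simp: cgenideal_def)
  have "c \<otimes> (s \<otimes> a) = (c \<otimes> s) \<otimes> a" using c(1) s a by (simp add: m_assoc)
  also have "\<dots> = a" using c(2)[symmetric] a by simp
  finally have "a = c \<otimes> (s \<otimes> a)" ..
  then show "a \<in> {\<zero>}" using sa c by simp
qed

text \<open>Nakayama's lemma with \<open>A = {\<zero>}\<close> and \<open>B\<close> the maximal
  ideal; zero is saturated there because elements outside the maximal ideal are units.\<close>

lemma max_ideal_square:
  assumes "max_ideal R \<subseteq> ideal_prod R (max_ideal R) (max_ideal R)"
  shows "max_ideal R = {\<zero>}"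
proof -
  interpret m: ideal "max_ideal R" R by (rule max_ideal_ideal)
  have "{\<zero>} = max_ideal R"
  proof (rule saturated_nakayama[OF max_ideal_prime zeroideal saturated_max_ideal_zero max_ideal_ideal
        prime_saturated[OF max_ideal_prime subset_refl]])
    show "{\<zero>} \<subseteq> max_ideal R" by simp
    fix b assume b: "b \<in> max_ideal R"
    have "\<one> \<otimes> b = \<zero> \<oplus> b" using m.Icarr[OF b] by simp
    moreover have "b \<in> ideal_prod R (max_ideal R) (max_ideal R)" using b assms by blast
    ultimately show "\<exists>s\<in>carrier R - max_ideal R.
        s \<otimes> b \<in> {\<zero>} <+> ideal_prod R (max_ideal R) (max_ideal R)"
      using max_ideal_one_notin by (intro bexI[of _ \<one>]) (auto simp: set_add_def')
  qed
  then show ?thesis by simp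
qed

text \<open>The first term of a nonempty regular sequence works. Its regularity is stated for a
  coset modulo the ideal generated by the empty set, so the proof only translates back from that
  quotient.\<close>

lemma exists_regular_in_max_ideal:
  assumes "depth R > 0"
  shows "\<exists>z \<in> max_ideal R. regular_element R z"
proof -
  interpret m: ideal "max_ideal R" R by (rule max_ideal_ideal)
  obtain xs where xs: "set xs \<subseteq> max_ideal R" "regular_seq R xs" "xs \<noteq> []"
    using assms by (auto simp: depth_def less_Sup_iff zero_enat_def)
  have I: "Idl {} = {\<zero>}"
    using genideal_minimal[OF zeroideal, of "{}"] additive_subgroup.zero_closed[OF ideal.axioms(1)[OF genideal_ideal[of "{}"]]]
    by auto
  interpret Z: ideal "{\<zero>}" R by (rule zeroideal)
  have reg: "regular_element (R Quot {\<zero>}) ({\<zero>} +> xs ! 0)"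
    using xs(2,3) I by (auto simp: regular_seq_def Let_def dest: spec[of _ 0])
  have z: "xs ! 0 \<in> max_ideal R" using xs(1,3) by (auto simp: subset_iff)
  then have zc: "xs ! 0 \<in> carrier R" by (rule m.Icarr)
  have "a = \<zero>" if a: "a \<in> carrier R" "xs ! 0 \<otimes> a = \<zero>" for a
  proof -
    have "({\<zero>} +> xs ! 0) \<otimes>\<^bsub>R Quot {\<zero>}\<^esub> ({\<zero>} +> a) = \<zero>\<^bsub>R Quot {\<zero>}\<^esub>"
      using a zc a_rcos_zero[OF zeroideal] by (simp add: FactRing_def Z.rcoset_mult_add)
    moreover have "{\<zero>} +> a \<in> carrier (R Quot {\<zero>})"
      using a(1) by (auto simp: FactRing_def A_RCOSETS_def' )
    ultimately have "{\<zero>} +> a = {\<zero>}"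
      using reg by (auto simp: regular_element_def FactRing_def)
    then show ?thesis using Z.rcos_const_imp_mem[OF a(1)] by simp
  qed
  then show ?thesis using z zc unfolding regular_element_def by blast
qed

text \<open>Besides \<open>F\<close>, the finitely many primes made of zero divisors are avoided. A
  prime containing the square of the maximal ideal is the maximal ideal itself; members of
  \<open>F\<close> are not maximal, and the other primes miss the regular element that positive
  depth provides.\<close>

lemma exists_regular_avoiding:
  assumes depth: "depth R > 0" and F: "finite F" "\<And>p. p \<in> F \<Longrightarrow> primeideal p R \<and> \<not> maximalideal p R"
  shows "\<exists>x. regular_element R x \<and>
    x \<in> max_ideal R - (ideal_prod R (max_ideal R) (max_ideal R) \<union> \<Union>F)"
proof -
  let ?m = "max_ideal R"
  interpret m: ideal ?m R by (rule max_ideal_ideal)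
  obtain z where z: "z \<in> ?m" "regular_element R z"
    using exists_regular_in_max_ideal[OF depth] by blast
  obtain G where G: "finite G" "\<And>p. p \<in> G \<Longrightarrow> primeideal p R"
    "\<And>p x. p \<in> G \<Longrightarrow> x \<in> p \<Longrightarrow> \<not> regular_element R x"
    "\<And>x. x \<in> carrier R \<Longrightarrow> \<not> regular_element R x \<Longrightarrow> x \<in> \<Union>G"
    using zero_divisors_finite_union by metis
  have nz: "?m \<noteq> {\<zero>}"
  proof
    assume "?m = {\<zero>}"
    then have "regular_element R \<zero>" using z by simp
    then have "\<one> = \<zero>" by (auto simp: regular_element_def)
    then show False using max_ideal_one_notin by simp
  qed
  have sq: "?m \<subseteq> p" if p: "primeideal p R" "ideal_prod R ?m ?m \<subseteq> p" for p
  proof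
    fix a assume a: "a \<in> ?m"
    then have "a \<otimes> a \<in> p" using p(2) ideal_prod.prod[of a ?m a ?m R] by blast
    then show "a \<in> p" using primeideal.I_prime[OF p(1)] m.Icarr[OF a] by blast
  qed
  have "\<exists>x\<in>?m. x \<notin> ideal_prod R ?m ?m \<and> x \<notin> \<Union>(F \<union> G)"
  proof (rule prime_avoidance)
    show "ideal ?m R" "ideal (ideal_prod R ?m ?m) R"
      by (intro ideal_prod_is_ideal max_ideal_ideal)+
    show "ideal_prod R ?m ?m \<subseteq> ?m" using ideal_prod_inter[OF max_ideal_ideal max_ideal_ideal] by blast
    show "\<not> ?m \<subseteq> ideal_prod R ?m ?m" using max_ideal_square nz by blast
    show "finite (F \<union> G)" using F G by blast
    fix p assume p: "p \<in> F \<union> G"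
    show "primeideal p R \<and> \<not> ideal_prod R ?m ?m \<subseteq> p"
    proof (intro conjI notI)
      show pr: "primeideal p R" using p F G by blast
      assume "ideal_prod R ?m ?m \<subseteq> p"
      then have "p = ?m" using sq[OF pr] prime_subset_max_ideal[OF pr] by blast
      then show False using p F(2) G(3) z max_ideal_maximal by blast
    qed
  qed
  then obtain x where "x \<in> ?m" "x \<notin> ideal_prod R ?m ?m" "x \<notin> \<Union>(F \<union> G)" by blast
  moreover from this have "regular_element R x" using G(4) m.Icarr by blast
  ultimately show ?thesis by blast
qed

end

section \<open>Quotients\<close>

text \<open>Covers the projection to \<open>ring_mod_elem\<close> as well as composites of such
  projections, whose kernels control termination.\<close>

locale surjective_ring_hom = ring_hom_cring R S h
  for R (structure) and S (structure) and h +
  assumes surj: "h ` carrier R = carrier S"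
begin

lemma surjE:
  assumes "b \<in> carrier S"
  obtains a where "a \<in> carrier R" "b = h a"
  using assms surj by blast

lemma image_vimage:
  assumes "J \<subseteq> carrier S"
  shows "h ` {r \<in> carrier R. h r \<in> J} = J"
  using assms unfolding surj[symmetric] by auto

lemma image_ideal:
  assumes "ideal K R"
  shows "ideal (h ` K) S"
proof -
  interpret K: ideal K R by fact
  show ?thesis
  proof (rule S.ideal_intro)
    show "h ` K \<subseteq> carrier S" using K.Icarr by auto
    show "\<zero>\<^bsub>S\<^esub> \<in> h ` K" using K.zero_closed hom_zero by (metis imageI)
  next
    fix a b assume "a \<in> h ` K" "b \<in> h ` K"
    then obtain u v where "u \<in> K" "v \<in> K" "a = h u" "b = h v" by blast
    moreover from this have "h (u \<oplus> v) = a \<oplus>\<^bsub>S\<^esub> b" using K.Icarr by simp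
    ultimately show "a \<oplus>\<^bsub>S\<^esub> b \<in> h ` K" using K.a_closed by (metis imageI)
  next
    fix a c assume "a \<in> h ` K" "c \<in> carrier S"
    then obtain u v where "u \<in> K" "a = h u" "v \<in> carrier R" "c = h v" using surj by blast
    moreover from this have "h (v \<otimes> u) = c \<otimes>\<^bsub>S\<^esub> a" using K.Icarr by simp
    ultimately show "c \<otimes>\<^bsub>S\<^esub> a \<in> h ` K" using K.I_l_closed by (metis imageI)
  qed
qed

lemma mem_image_iff:
  assumes K: "ideal K R" "{r \<in> carrier R. h r = \<zero>\<^bsub>S\<^esub>} \<subseteq> K" and a: "a \<in> carrier R"
  shows "h a \<in> h ` K \<longleftrightarrow> a \<in> K"
proof
  interpret K: ideal K R by (rule K)
  assume "h a \<in> h ` K"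
  then obtain k where k: "k \<in> K" "h a = h k" by blast
  have kc: "k \<in> carrier R" using k K.Icarr by blast
  have "h (a \<ominus> k) = h a \<ominus>\<^bsub>S\<^esub> h k" using a kc by (simp add: R.minus_eq S.minus_eq)
  also have "\<dots> = \<zero>\<^bsub>S\<^esub>" using k(2) kc by (simp add: S.r_neg S.minus_eq)
  finally have "a \<ominus> k \<in> K" using K(2) a kc by auto
  then have "(a \<ominus> k) \<oplus> k \<in> K" using k K.a_closed by blast
  moreover have "(a \<ominus> k) \<oplus> k = a" using a kc by algebra
  ultimately show "a \<in> K" by simp
qed auto

lemma image_prime:
  assumes p: "primeideal p R" "{r \<in> carrier R. h r = \<zero>\<^bsub>S\<^esub>} \<subseteq> p"
  shows "primeideal (h ` p) S"
proof -
  interpret p: primeideal p R by (rule p)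
  note mem = mem_image_iff[OF p.is_ideal p(2)]
  show ?thesis
  proof (rule primeidealI[OF image_ideal[OF p.is_ideal] S.is_cring])
    show "carrier S \<noteq> h ` p"
    proof
      assume "carrier S = h ` p"
      then have "h \<one> \<in> h ` p" by (metis S.one_closed hom_one)
      then show False using mem[of \<one>] R.prime_one_notin[OF p(1)] by simp
    qed
    fix a b assume a: "a \<in> carrier S" and b: "b \<in> carrier S" and ab: "a \<otimes>\<^bsub>S\<^esub> b \<in> h ` p"
    obtain u v where uv: "u \<in> carrier R" "a = h u" "v \<in> carrier R" "b = h v"
      using a b by (metis surjE)
    then have "h (u \<otimes> v) \<in> h ` p" using ab by simp
    then have "u \<otimes> v \<in> p" using mem[of "u \<otimes> v"] uv by simp
    then show "a \<in> h ` p \<or> b \<in> h ` p" using p.I_prime uv by blast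
  qed
qed

lemma image_noetherian:
  assumes "noetherian_ring R"
  shows "noetherian_ring S"
proof (rule S.noetherian_ringI)
  fix J assume J: "ideal J S"
  let ?V = "\<lambda>J. {r \<in> carrier R. h r \<in> J}"
  obtain A where A: "A \<subseteq> carrier R" "finite A" "?V J = Idl A"
    using noetherian_ring.finetely_gen[OF assms ring.ideal_vimage[OF J]] by blast
  have hA: "h ` A \<subseteq> carrier S" using A(1) by auto
  have "h ` A \<subseteq> J" using R.genideal_self[OF A(1)] A(3) by blast
  then have "Idl\<^bsub>S\<^esub> (h ` A) \<subseteq> J" by (rule S.genideal_minimal[OF J])
  moreover have "A \<subseteq> ?V (Idl\<^bsub>S\<^esub> (h ` A))" using A(1) S.genideal_self[OF hA] by blast
  then have "?V J \<subseteq> ?V (Idl\<^bsub>S\<^esub> (h ` A))"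
    unfolding A(3) by (rule R.genideal_minimal[OF ring.ideal_vimage[OF S.genideal_ideal[OF hA]]])
  then have "J \<subseteq> Idl\<^bsub>S\<^esub> (h ` A)"
    using surj ideal.Icarr[OF J] by (auto elim!: surjE)
  ultimately show "\<exists>A\<subseteq>carrier S. finite A \<and> J = Idl\<^bsub>S\<^esub> A"
    using A(2) hA by (intro exI[of _ "h ` A"]) auto
qed

text \<open>Proper ideals of \<open>S\<close> pull back to proper ideals of \<open>R\<close>, so all
  of them lie in the image of the maximal ideal; \<open>ker\<close> makes that image proper.\<close>

lemma image_local:
  assumes R: "noeth_local_ring R" and ker: "{r \<in> carrier R. h r = \<zero>\<^bsub>S\<^esub>} \<subseteq> max_ideal R"
  shows "noeth_local_ring S" "max_ideal S = h ` max_ideal R"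
proof -
  interpret L: noeth_local_ring R by (rule R)
  let ?M = "h ` max_ideal R"
  have le: "J \<subseteq> ?M" if J: "ideal J S" "J \<noteq> carrier S" for J
  proof -
    have V: "ideal {r \<in> carrier R. h r \<in> J} R" by (rule ring.ideal_vimage[OF J(1)])
    have "\<one>\<^bsub>S\<^esub> \<notin> J" using ideal.one_imp_carrier[OF J(1)] J(2) by blast
    then have "\<one> \<notin> {r \<in> carrier R. h r \<in> J}" by simp
    then have "{r \<in> carrier R. h r \<in> J} \<noteq> carrier R" by blast
    then have "h ` {r \<in> carrier R. h r \<in> J} \<subseteq> ?M"
      by (intro image_mono L.proper_ideal_subset_max_ideal V)
    then show ?thesis using image_vimage[of J] ideal.Icarr[OF J(1)] by blast
  qed
  have pr: "primeideal ?M S" by (rule image_prime[OF L.max_ideal_prime ker])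
  have M: "ideal ?M S" "carrier S \<noteq> ?M"
    using pr by (auto simp: primeideal_def primeideal.I_notcarr)
  have mx: "maximalideal ?M S"
    using M le by (intro maximalidealI) blast+
  have uniq: "K = ?M" if K: "maximalideal K S" for K
  proof -
    interpret K: maximalideal K S by (rule K)
    have "?M = K \<or> ?M = carrier S"
      using K.I_notcarr le[OF K.is_ideal] ideal.Icarr[OF M(1)] by (intro K.I_maximal M) blast+
    then show ?thesis using M(2) by blast
  qed
  show "noeth_local_ring S"
    using image_noetherian[OF L.noetherian_ring_axioms] mx uniq S.is_cring
    by (auto simp: noeth_local_ring_def noeth_local_ring_axioms_def)
  show "max_ideal S = ?M"
    unfolding max_ideal_def[of S] by (intro the_equality mx uniq)
qed

end

text \<open>By the last clause an element of the quotient is an element of \<open>R\<close> fixed by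
  \<open>h\<close>, that is, its own lift.\<close>

lemma (in cring) ring_mod_elem_hom:
  assumes x: "x \<in> carrier R"
  defines "h \<equiv> coset_rep R (PIdl x)" and "S \<equiv> ring_mod_elem R x"
  shows "surjective_ring_hom R S h"
    and "\<And>a. a \<in> carrier R \<Longrightarrow> h a = \<zero>\<^bsub>S\<^esub> \<longleftrightarrow> a \<in> PIdl x"
    and "\<And>b. b \<in> carrier S \<Longrightarrow> b \<in> carrier R \<and> h b = b"
proof -
  interpret I: ideal "PIdl x" R by (rule cgenideal_ideal[OF x])
  have as: "abelian_subgroup (PIdl x) R" by unfold_locales
  interpret S: cring S
    unfolding S_def ring_mod_elem_def by (rule quot_ring_cring[OF is_cring I.is_ideal])
  have hom: "h \<in> ring_hom R S"
    by (rule ring_hom_memI)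
      (simp_all add: S_def ring_mod_elem_def quot_ring_def h_def coset_rep_mult[OF I.is_ideal] coset_rep_add[OF as])
  show "surjective_ring_hom R S h"
    by (unfold_locales) (use hom in \<open>simp_all add: S_def ring_mod_elem_def quot_ring_def h_def\<close>)
  show "h a = \<zero>\<^bsub>S\<^esub> \<longleftrightarrow> a \<in> PIdl x" if "a \<in> carrier R" for a
    using coset_rep_eq_iff[OF as that zero_closed] that
    by (simp add: S_def ring_mod_elem_def quot_ring_def h_def minus_eq)
  show "b \<in> carrier R \<and> h b = b" if b: "b \<in> carrier S" for b
  proof -
    obtain a where a: "a \<in> carrier R" "b = h a"
      using b by (auto simp: S_def ring_mod_elem_def quot_ring_def h_def)
    have "h a \<in> carrier R" unfolding h_def by (rule coset_rep_closed[OF as a(1)])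
    moreover have "h (h a) = h a"
      unfolding h_def using coset_coset_rep[OF as a(1)] coset_rep_closed[OF as a(1)]
      by (simp add: coset_rep_eq_iff_coset[OF as _ a(1)])
    ultimately show ?thesis using a by simp
  qed
qed

section \<open>Lifting regularity along a regular element\<close>

text \<open>
  The clause \<open>\<zero> \<notin> A\<close> ensures that lifting the generators \<open>A\<close> of the maximal ideal of \<open>R/xR\<close> and
  adjoining \<open>x\<close> increases the cardinality by exactly one.
\<close>

definition regular_of_dim :: "('a, 'b) ring_scheme \<Rightarrow> nat \<Rightarrow> bool"
  where "regular_of_dim R d \<longleftrightarrow>
    (\<exists>p. prime_chain R d p) \<and> (\<forall>n p. prime_chain R n p \<longrightarrow> n \<le> d) \<and>
    (\<exists>A \<subseteq> carrier R. finite A \<and> \<zero>\<^bsub>R\<^esub> \<notin> A \<and> card A = d \<and> Idl\<^bsub>R\<^esub> A = max_ideal R)"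

lemma regular_of_dim_imp_regular_local_ring:
  assumes "noeth_local_ring R" "regular_of_dim R d"
  shows "regular_local_ring R"
proof -
  have "krull_dim R = Sup {enat n | n. \<exists>p. prime_chain R n p}"
    by (simp add: krull_dim_def prime_chain_def)
  also have "\<dots> = enat d"
    using assms(2) by (intro antisym Sup_least Sup_upper) (auto simp: regular_of_dim_def)
  finally show ?thesis
    using assms by (auto simp: regular_of_dim_def regular_local_ring_def)
qed

lemma (in noeth_local_ring) field_regular_of_dim:
  assumes "field R"
  shows "regular_of_dim R 0"
proof -
  interpret F: field R by fact
  have prime: "p = {\<zero>}" if "primeideal p R" for p
  proof -
    interpret p: primeideal p R by fact
    show ?thesis using F.all_ideals p.is_ideal p.I_notcarr by blast
  qed
  have m: "max_ideal R = {\<zero>}" by (rule prime[OF max_ideal_prime])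
  have chain: "prime_chain R 0 (\<lambda>_. {\<zero>})"
    using max_ideal_prime m by (simp add: prime_chain_def)
  have "n = 0" if "prime_chain R n p" for n p
  proof (rule ccontr)
    assume "n \<noteq> 0"
    then have "primeideal (p 0) R" "primeideal (p 1) R" "p 0 \<subset> p 1"
      using that by (auto simp: prime_chain_def)
    then show False using prime by blast
  qed
  moreover have "Idl {} = {\<zero>}"
  proof
    show "Idl {} \<subseteq> {\<zero>}" by (intro genideal_minimal zeroideal) simp
    show "{\<zero>} \<subseteq> Idl {}"
      using additive_subgroup.zero_closed[OF ideal.axioms(1)[OF genideal_ideal[of "{}"]]] by simp
  qed
  ultimately show ?thesis
    unfolding regular_of_dim_def using chain m by (intro conjI exI[of _ "{}"]) auto
qed

text \<open>Regularity of \<open>x\<close> yields a chain one longer than in the quotient, and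
  Krull's theorem, through \<open>prime_chain_containing\<close>, bounds all chains by that
  length.\<close>

lemma (in noeth_local_ring) regular_of_dim_lift:
  assumes x: "x \<in> max_ideal R" "regular_element R x"
    and reg: "regular_of_dim (ring_mod_elem R x) d"
  shows "regular_of_dim R (Suc d)"
proof -
  define h where "h = coset_rep R (PIdl x)"
  define S where "S = ring_mod_elem R x"
  interpret m: ideal "max_ideal R" R by (rule max_ideal_ideal)
  have xc: "x \<in> carrier R" using m.Icarr[OF x(1)] .
  interpret h: surjective_ring_hom R S h
    unfolding S_def h_def by (rule ring_mod_elem_hom[OF xc])
  have ker: "h a = \<zero>\<^bsub>S\<^esub> \<longleftrightarrow> a \<in> PIdl x" if "a \<in> carrier R" for a
    unfolding S_def h_def by (rule ring_mod_elem_hom(2)[OF xc that])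
  have rep: "b \<in> carrier R" "h b = b" if "b \<in> carrier S" for b
    using ring_mod_elem_hom(3)[OF xc] that unfolding S_def h_def by auto
  have xP: "x \<in> PIdl x" by (rule cgenideal_self[OF xc])
  have kerK: "{r \<in> carrier R. h r = \<zero>\<^bsub>S\<^esub>} \<subseteq> K" if "ideal K R" "x \<in> K" for K
    using ker cgenideal_minimal[OF that] by blast
  have mS: "max_ideal S = h ` max_ideal R"
    by (rule h.image_local[OF noeth_local_ring_axioms kerK[OF max_ideal_ideal x(1)]])
  have hx: "h x = \<zero>\<^bsub>S\<^esub>" using ker xc xP by blast
  from reg obtain p A where p: "prime_chain S d p" and bound: "\<And>n p. prime_chain S n p \<Longrightarrow> n \<le> d"
    and A: "A \<subseteq> carrier S" "finite A" "\<zero>\<^bsub>S\<^esub> \<notin> A" "card A = d" "Idl\<^bsub>S\<^esub> A = max_ideal S"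
    unfolding regular_of_dim_def S_def by blast

  have "\<exists>p. prime_chain R (Suc d) p"
  proof -
    define q where "q i = {r \<in> carrier R. h r \<in> p i}" for i
    have qp: "primeideal (q i) R" if "i \<le> d" for i
      using p that unfolding q_def
      by (intro h.ring.primeideal_vimage is_cring) (auto simp: prime_chain_def)
    have pi: "p i = h ` q i" if "i \<le> d" for i
    proof -
      have "ideal (p i) S" using p that by (auto simp: prime_chain_def primeideal_def)
      then have "p i \<subseteq> carrier S" by (rule additive_subgroup.a_subset[OF ideal.axioms(1)])
      then show ?thesis unfolding q_def by (rule h.image_vimage[symmetric])
    qed
    have qs: "q i \<subset> q (Suc i)" if "i < d" for i
    proof -
      have "p i \<subset> p (Suc i)" using p that by (auto simp: prime_chain_def)
      then have "q i \<subseteq> q (Suc i)" and "p i \<noteq> p (Suc i)" by (auto simp: q_def)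
      moreover from this(2) have "q i \<noteq> q (Suc i)" using pi that by (metis Suc_leI less_imp_le)
      ultimately show ?thesis by blast
    qed
    have "ideal (p 0) S" using p by (auto simp: prime_chain_def primeideal_def)
    then have xq: "x \<in> q 0"
      using hx xc additive_subgroup.zero_closed[OF ideal.axioms(1)] by (simp add: q_def)
    \<comment> \<open>The preimages all contain \<open>x\<close>, so a prime inside
      \<open>q 0\<close> that omits \<open>x\<close> is strictly smaller and becomes the new
      bottom.\<close>
    obtain p' where p': "primeideal p' R" "p' \<subseteq> q 0" "x \<notin> p'"
      using exists_prime_avoiding_regular[OF qp[of 0] x(2)] by blast
    have "prime_chain R (Suc d) (case_nat p' q)"
      unfolding prime_chain_def
    proof (intro conjI allI impI)
      fix i assume "i \<le> Suc d"
      then show "primeideal (case_nat p' q i) R" using p' qp by (cases i) auto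
    next
      fix i assume "i < Suc d"
      then show "case_nat p' q i \<subset> case_nat p' q (Suc i)"
        using p' xq qs by (cases i) auto
    qed
    then show ?thesis by blast
  qed
  moreover have "n \<le> Suc d" if q: "prime_chain R n q" for n q
  proof (cases n)
    case (Suc k)
    \<comment> \<open>\<open>prime_chain_containing\<close> wants \<open>x\<close> in the top prime;
      replacing the top by the maximal ideal arranges this and keeps the chain strict.\<close>
    have "prime_chain R (Suc k) (q(Suc k := max_ideal R))"
      using q prime_subset_max_ideal[of "q (Suc k)"] max_ideal_prime
      by (auto simp: prime_chain_def Suc less_Suc_eq)
    from prime_chain_containing[OF this, of x] x(1)
    obtain q' where q': "prime_chain R k q'" "\<forall>i\<le>k. x \<in> q' i" by auto
    have q'i: "ideal (q' i) R" "primeideal (q' i) R" "{r \<in> carrier R. h r = \<zero>\<^bsub>S\<^esub>} \<subseteq> q' i" if "i \<le> k" for i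
    proof -
      show pr: "primeideal (q' i) R" using q' that by (auto simp: prime_chain_def)
      then show "ideal (q' i) R" by (rule primeideal.axioms)
      then show "{r \<in> carrier R. h r = \<zero>\<^bsub>S\<^esub>} \<subseteq> q' i" using kerK q'(2) that by blast
    qed
    have "prime_chain S k (\<lambda>i. h ` q' i)"
      unfolding prime_chain_def
    proof (intro conjI allI impI)
      fix i assume "i \<le> k"
      then show "primeideal (h ` q' i) S" using q'i by (intro h.image_prime)
    next
      fix i assume i: "i < k"
      then have "q' i \<subset> q' (Suc i)" using q'(1) by (auto simp: prime_chain_def)
      then obtain a where a: "a \<in> q' (Suc i)" "a \<notin> q' i" and sub: "q' i \<subseteq> q' (Suc i)" by blast
      have "a \<in> carrier R" using ideal.Icarr[OF q'i(1) a(1)] i by simp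
      then have "h a \<notin> h ` q' i" using h.mem_image_iff[OF q'i(1,3)] a i by simp
      then show "h ` q' i \<subset> h ` q' (Suc i)" using a sub by blast
    qed
    then show ?thesis using bound Suc by simp
  qed simp
  moreover have "\<exists>A \<subseteq> carrier R. finite A \<and> \<zero> \<notin> A \<and> card A = Suc d \<and> Idl A = max_ideal R"
  proof (intro exI[of _ "insert x A"] conjI)
    have Ac: "A \<subseteq> carrier R" using rep A(1) by blast
    then show sub: "insert x A \<subseteq> carrier R" using xc by blast
    show "finite (insert x A)" using A by simp
    \<comment> \<open>Elements of \<open>A\<close> are fixed by \<open>h\<close>, so
      \<open>x\<close> in \<open>A\<close> would equal \<open>h x\<close>, the zero of
      \<open>S\<close>, which \<open>A\<close> excludes. The same argument keeps
      \<open>\<zero>\<close> out of \<open>A\<close>.\<close>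
    have "x \<notin> A" using hx rep(2)[of x] A(1,3) by auto
    then show "card (insert x A) = Suc d" using A by simp
    have "\<zero> \<notin> A" using h.hom_zero rep(2)[of \<zero>] A(1,3) by auto
    moreover have "x \<noteq> \<zero>"
    proof
      assume "x = \<zero>"
      then have "\<one> = \<zero>" using x(2) by (auto simp: regular_element_def)
      then show False using max_ideal_one_notin m.zero_closed by simp
    qed
    ultimately show "\<zero> \<notin> insert x A" by blast
    have ha: "h a = a" if "a \<in> A" for a using rep(2) A(1) that by blast
    then have hA: "h ` A = A" by simp
    show "Idl (insert x A) = max_ideal R"
    proof
      show "Idl (insert x A) \<subseteq> max_ideal R"
      proof (rule genideal_minimal[OF max_ideal_ideal], rule insert_subsetI[OF x(1)], rule subsetI)
        fix a assume a: "a \<in> A"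
        then have "h a \<in> h ` max_ideal R"
          using A(5) ha h.S.genideal_self[OF A(1)] mS by auto
        then show "a \<in> max_ideal R"
          using h.mem_image_iff[OF max_ideal_ideal kerK[OF max_ideal_ideal x(1)]] a Ac by blast
      qed
      \<comment> \<open>Both ideals contain \<open>x\<close>, hence the kernel of \<open>h\<close>,
        so the inclusion can be tested on images, where \<open>A\<close> generates.\<close>
      note K = genideal_ideal[OF sub] and selfK = genideal_self[OF sub]
      have "A \<subseteq> h ` (Idl (insert x A))" using hA selfK by blast
      then have hm: "h ` max_ideal R \<subseteq> h ` (Idl (insert x A))"
        unfolding mS[symmetric] A(5)[symmetric] by (rule h.S.genideal_minimal[OF h.image_ideal[OF K]])
      show "max_ideal R \<subseteq> Idl (insert x A)"
        using hm h.mem_image_iff[OF K kerK[OF K]] selfK m.Icarr by blast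
    qed
  qed
  ultimately show ?thesis unfolding regular_of_dim_def by blast
qed

section \<open>Descent through quotients by regular elements\<close>

theorem theorem1p2:
  fixes P Q :: "'a ring \<Rightarrow> ('a, 'm) module \<Rightarrow> bool"
    and le :: "'a ring \<Rightarrow> ('a, 'm) module \<Rightarrow> ('a, 'm) module \<Rightarrow> bool"
  assumes c1_P: "\<And>R V. noeth_local_ring R \<Longrightarrow> module R V \<Longrightarrow> depth R > 0 \<Longrightarrow> P R V \<Longrightarrow>
      \<exists>F. finite F \<and> (\<forall>p \<in> F. primeideal p R \<and> \<not> maximalideal p R) \<and>
        (\<forall>x. regular_element R x \<and>
             x \<in> max_ideal R - (ideal_prod R (max_ideal R) (max_ideal R) \<union> \<Union>F) \<longrightarrow>
             P (ring_mod_elem R x) (module_mod_elem V x))"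
    and c1_Q: "\<And>R V. noeth_local_ring R \<Longrightarrow> module R V \<Longrightarrow> depth R > 0 \<Longrightarrow> Q R V \<Longrightarrow>
      \<exists>F. finite F \<and> (\<forall>p \<in> F. primeideal p R \<and> \<not> maximalideal p R) \<and>
        (\<forall>x. regular_element R x \<and>
             x \<in> max_ideal R - (ideal_prod R (max_ideal R) (max_ideal R) \<union> \<Union>F) \<longrightarrow>
             Q (ring_mod_elem R x) (module_mod_elem V x))"
    and c2: "\<And>R V. noeth_local_ring R \<Longrightarrow> module R V \<Longrightarrow> depth R = 0 \<Longrightarrow> P R V \<Longrightarrow>
      \<not> socle R \<subseteq> annihilator R V"
    and c3: "\<And>R V. noeth_local_ring R \<Longrightarrow> module R V \<Longrightarrow> depth R = 0 \<Longrightarrow> Q R V \<Longrightarrow>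
      \<not> field R \<Longrightarrow> socle R \<subseteq> annihilator R V"
    and c4: "\<And>R V W. noeth_local_ring R \<Longrightarrow> module R V \<Longrightarrow> module R W \<Longrightarrow> depth R > 0 \<Longrightarrow>
      le R V W \<Longrightarrow>
      \<exists>F. finite F \<and> (\<forall>p \<in> F. primeideal p R \<and> \<not> maximalideal p R) \<and>
        (\<forall>x. regular_element R x \<and>
             x \<in> max_ideal R - (ideal_prod R (max_ideal R) (max_ideal R) \<union> \<Union>F) \<longrightarrow>
             le (ring_mod_elem R x) (module_mod_elem V x) (module_mod_elem W x))"
    and c5: "\<And>R V W. noeth_local_ring R \<Longrightarrow> module R V \<Longrightarrow> module R W \<Longrightarrow> depth R = 0 \<Longrightarrow>
      le R V W \<Longrightarrow> annihilator R V \<subseteq> annihilator R W"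
  fixes R :: "'a ring"
  assumes "noeth_local_ring R"
    and "\<exists>M N. module R M \<and> module R N \<and> Q R M \<and> P R N \<and> le R M N"
  shows "regular_local_ring R"
proof (rule ccontr)
  define good where "good R \<longleftrightarrow> noeth_local_ring R \<and>
    (\<exists>M N. module R M \<and> module R N \<and> Q R M \<and> P R N \<and> le R M N)" for R
  \<comment> \<open>Failure is measured by \<open>regular_of_dim\<close>, the form of regularity
    that lifts from the quotient; a ring that is not regular is bad in this sense too.\<close>
  define bad where "bad R \<longleftrightarrow> good R \<and> (\<nexists>d. regular_of_dim R d)" for R
  have step: "\<exists>x. x \<noteq> \<zero>\<^bsub>R\<^esub> \<and> x \<in> carrier R \<and> bad (ring_mod_elem R x)" if bad: "bad R" for R
  proof -
    obtain M N where R: "noeth_local_ring R" and MN: "module R M" "module R N" "Q R M" "P R N" "le R M N"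
      and nreg: "\<nexists>d. regular_of_dim R d"
      using bad by (auto simp: bad_def good_def)
    interpret noeth_local_ring R by (rule R)
    have "depth R > 0"
    proof (rule ccontr)
      assume "\<not> depth R > 0"
      then have d: "depth R = 0" by simp
      \<comment> \<open>For a non-field, \<open>socle R \<subseteq> annihilator R M \<subseteq>
        annihilator R N\<close>, against condition (2).\<close>
      have "\<not> field R" using field_regular_of_dim nreg by blast
      then show False
        using c3[OF R MN(1) d MN(3)] c5[OF R MN(1,2) d MN(5)] c2[OF R MN(2) d MN(4)] by blast
    qed
    note d = this
    have "\<exists>F. finite F \<and> (\<forall>p \<in> F. primeideal p R \<and> \<not> maximalideal p R) \<and>
        (\<forall>x. regular_element R x \<and>
             x \<in> max_ideal R - (ideal_prod R (max_ideal R) (max_ideal R) \<union> \<Union>F) \<longrightarrow>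
             Q (ring_mod_elem R x) (module_mod_elem M x) \<and>
             P (ring_mod_elem R x) (module_mod_elem N x) \<and>
             le (ring_mod_elem R x) (module_mod_elem M x) (module_mod_elem N x))"
    proof -
      obtain F where F: "finite F" "\<forall>p \<in> F. primeideal p R \<and> \<not> maximalideal p R"
        "\<And>x. regular_element R x \<and> x \<in> max_ideal R - (ideal_prod R (max_ideal R) (max_ideal R) \<union> \<Union>F) \<Longrightarrow>
             Q (ring_mod_elem R x) (module_mod_elem M x)"
        using c1_Q[OF R MN(1) d MN(3)] by auto
      obtain G where G: "finite G" "\<forall>p \<in> G. primeideal p R \<and> \<not> maximalideal p R"
        "\<And>x. regular_element R x \<and> x \<in> max_ideal R - (ideal_prod R (max_ideal R) (max_ideal R) \<union> \<Union>G) \<Longrightarrow>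
             P (ring_mod_elem R x) (module_mod_elem N x)"
        using c1_P[OF R MN(2) d MN(4)] by auto
      obtain H where H: "finite H" "\<forall>p \<in> H. primeideal p R \<and> \<not> maximalideal p R"
        "\<And>x. regular_element R x \<and> x \<in> max_ideal R - (ideal_prod R (max_ideal R) (max_ideal R) \<union> \<Union>H) \<Longrightarrow>
             le (ring_mod_elem R x) (module_mod_elem M x) (module_mod_elem N x)"
        using c4[OF R MN(1,2) d MN(5)] by auto
      show ?thesis
        using F(1,2) G(1,2) H(1,2) by (intro exI[of _ "F \<union> G \<union> H"] conjI allI impI F(3) G(3) H(3)) auto
    qed
    then obtain x where x: "regular_element R x" "x \<in> max_ideal R"
      and QPl: "Q (ring_mod_elem R x) (module_mod_elem M x)" "P (ring_mod_elem R x) (module_mod_elem N x)"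
        "le (ring_mod_elem R x) (module_mod_elem M x) (module_mod_elem N x)"
      using exists_regular_avoiding[OF d] by (metis DiffD1)
    have xc: "x \<in> carrier R" using x(1) by (simp add: regular_element_def)
    have ker: "{r \<in> carrier R. coset_rep R (PIdl\<^bsub>R\<^esub> x) r = \<zero>\<^bsub>ring_mod_elem R x\<^esub>} \<subseteq> max_ideal R"
      using ring_mod_elem_hom(2)[OF xc] cgenideal_minimal[OF max_ideal_ideal x(2)] by auto
    have "noeth_local_ring (ring_mod_elem R x)"
      by (rule surjective_ring_hom.image_local[OF ring_mod_elem_hom(1)[OF xc] R ker])
    then have "good (ring_mod_elem R x)"
      unfolding good_def using MN(1,2) QPl module_mod_elem_module[OF _ xc] by blast
    moreover have "\<nexists>d. regular_of_dim (ring_mod_elem R x) d"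
      using regular_of_dim_lift[OF x(2,1)] nreg by blast
    moreover have "x \<noteq> \<zero>\<^bsub>R\<^esub>"
    proof
      assume "x = \<zero>\<^bsub>R\<^esub>"
      then have "\<one>\<^bsub>R\<^esub> = \<zero>\<^bsub>R\<^esub>" using x(1) by (auto simp: regular_element_def)
      then show False
        using max_ideal_one_notin additive_subgroup.zero_closed[OF ideal.axioms(1)[OF max_ideal_ideal]] by simp
    qed
    ultimately show ?thesis using xc by (auto simp: bad_def)
  qed

  assume "\<not> regular_local_ring R"
  then have "bad R"
    using assms(7,8) regular_of_dim_imp_regular_local_ring by (auto simp: bad_def good_def)
  interpret noeth_local_ring R by fact
  \<comment> \<open>Ideals of different quotients cannot be compared, but kernels in the one ring
    \<open>R\<close> can. Ranging over all surjections onto bad rings replaces an explicit sequence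
    of quotients by a single maximal kernel.\<close>
  define S where "S = {{r \<in> carrier R. h r = \<zero>\<^bsub>R'\<^esub>} | h R'. bad R' \<and> surjective_ring_hom R R' h}"
  have "surjective_ring_hom R R (\<lambda>a. a)"
    by unfold_locales (auto simp: ring_hom_def)
  then have "S \<noteq> {}" using \<open>bad R\<close> by (auto simp: S_def)
  have S_ideal: "ideal I R" if "I \<in> S" for I
  proof -
    from \<open>I \<in> S\<close> obtain h and R' :: "'a ring" where I: "I = {r \<in> carrier R. h r = \<zero>\<^bsub>R'\<^esub>}" and h: "surjective_ring_hom R R' h"
      unfolding S_def by blast
    interpret h: surjective_ring_hom R R' h by (rule h)
    show ?thesis using h.ring.ideal_vimage[OF h.S.zeroideal] by (simp add: I)
  qed
  obtain M where "M \<in> S" and max: "\<And>I. I \<in> S \<Longrightarrow> M \<subseteq> I \<Longrightarrow> I = M"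
    using maximal_ideal_in_family[OF \<open>S \<noteq> {}\<close> S_ideal] by metis
  from \<open>M \<in> S\<close> obtain h and R' :: "'a ring" where M: "M = {r \<in> carrier R. h r = \<zero>\<^bsub>R'\<^esub>}"
    and "bad R'" and h: "surjective_ring_hom R R' h"
    unfolding S_def by blast
  interpret h: surjective_ring_hom R R' h by (rule h)
  obtain x where x: "x \<noteq> \<zero>\<^bsub>R'\<^esub>" "x \<in> carrier R'" "bad (ring_mod_elem R' x)"
    using step[OF \<open>bad R'\<close>] by blast
  define g where "g = coset_rep R' (PIdl\<^bsub>R'\<^esub> x)"
  interpret g: surjective_ring_hom R' "ring_mod_elem R' x" g
    unfolding g_def by (rule h.S.ring_mod_elem_hom[OF x(2)])
  have gker: "g a = \<zero>\<^bsub>ring_mod_elem R' x\<^esub> \<longleftrightarrow> a \<in> PIdl\<^bsub>R'\<^esub> x" if "a \<in> carrier R'" for a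
    unfolding g_def by (rule h.S.ring_mod_elem_hom(2)[OF x(2) that])
  have "surjective_ring_hom R (ring_mod_elem R' x) (g \<circ> h)"
  proof unfold_locales
    show "g \<circ> h \<in> ring_hom R (ring_mod_elem R' x)" by (rule ring_hom_trans[OF h.homh g.homh])
    show "(g \<circ> h) ` carrier R = carrier (ring_mod_elem R' x)"
      by (simp only: image_comp[symmetric] h.surj g.surj)
  qed
  then have "{r \<in> carrier R. (g \<circ> h) r = \<zero>\<^bsub>ring_mod_elem R' x\<^esub>} \<in> S"
    using x(3) unfolding S_def by blast
  moreover have "{r \<in> carrier R. h r = \<zero>\<^bsub>R'\<^esub>} \<subseteq> {r \<in> carrier R. (g \<circ> h) r = \<zero>\<^bsub>ring_mod_elem R' x\<^esub>}"
    by auto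
  ultimately have eq: "{r \<in> carrier R. (g \<circ> h) r = \<zero>\<^bsub>ring_mod_elem R' x\<^esub>} = {r \<in> carrier R. h r = \<zero>\<^bsub>R'\<^esub>}"
    unfolding M[symmetric] by (rule max)
  \<comment> \<open>A preimage of \<open>x\<close> lies in the new kernel but not in the old one, as
    \<open>x\<close> is nonzero in \<open>R'\<close>; this contradicts maximality.\<close>
  obtain a where a: "a \<in> carrier R" "x = h a" using h.surjE[OF x(2)] .
  have "g x = \<zero>\<^bsub>ring_mod_elem R' x\<^esub>" using gker[OF x(2)] h.S.cgenideal_self[OF x(2)] by blast
  then have "a \<in> {r \<in> carrier R. (g \<circ> h) r = \<zero>\<^bsub>ring_mod_elem R' x\<^esub>}" using a by simp
  then show False using eq a x(1) by blast
qed

end
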